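(* Let $C_1,C_2>0$, let $\mathcal{A}$ and $\mathcal{B}$ be Banach algebras, and let $\sigma_{\mathcal{A}}\in Hom(\mathcal{A})$ and $\sigma_{\mathcal{B}}\in Hom(\mathcal{B})$. Suppose that $\mathcal{A}$ is $C_1$-$\sigma_{\mathcal{A}}$-biflat, that $\mathcal{B}$ is $C_2$-$\sigma_{\mathcal{B}}$-biflat, and that both $\sigma_{\mathcal{A}}$ and $\sigma_{\mathcal{B}}$ are idempotents. Then $\mathcal{A}\widehat{\otimes}\mathcal{B}$ is $C_1C_2$-$(\sigma_{\mathcal{A}}\otimes\sigma_{\mathcal{B}})$-biflat.
   Context: For a Banach algebra $\mathcal{A}$, $Hom(\mathcal{A})$ is the set of all continuous algebra homomorphisms $\mathcal{A}\to\mathcal{A}$; $\sigma\in Hom(\mathcal{A})$ is idempotent if $\sigma\circ\sigma=\sigma$. The projective tensor product $\mathcal{A}\widehat{\otimes}\mathcal{A}$ is a Banach $\mathcal{A}$-bimodule via $a\cdot(b\otimes c)=ab\otimes c$ and $(b\otimes c)\cdot a=b\otimes ca$. The diagonal operator is $\pi_{\mathcal{A}}:\mathcal{A}\widehat{\otimes}\mathcal{A}\to\mathcal{A}$, $\pi_{\mathcal{A}}(a\otimes b)=ab$. For a Banach $\mathcal{A}$-bimodule $X$, the dual $X^*$ is a Banach $\mathcal{A}$-bimodule via $\langle a\cdot\lambda,x\rangle=\langle\lambda,x\cdot a\rangle$ and $\langle\lambda\cdot a,x\rangle=\langle\lambda,a\cdot x\rangle$. For $C>0$ and $\sigma\in Hom(\mathcal{A})$,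 the Banach algebra $\mathcal{A}$ is $C$-$\sigma$-biflat if there exists a bounded linear map $\rho:(\mathcal{A}\widehat{\otimes}\mathcal{A})^*\to\mathcal{A}^*$ such that $\rho(\sigma(a)\cdot\lambda)=a\cdot\rho(\lambda)$ and $\rho(\lambda\cdot\sigma(a))=\rho(\lambda)\cdot a$ for all $a\in\mathcal{A}$, $\lambda\in(\mathcal{A}\widehat{\otimes}\mathcal{A})^*$, with $\rho\circ\pi_{\mathcal{A}}^*=\sigma^*$ and $\|\rho\|<C$. For Banach algebras $\mathcal{A},\mathcal{B}$, $\mathcal{A}\widehat{\otimes}\mathcal{B}$ is the projective tensor product Banach algebra with $(a\otimes b)(a'\otimes b')=aa'\otimes bb'$, and $\sigma_{\mathcal{A}}\otimes\sigma_{\mathcal{B}}\in Hom(\mathcal{A}\widehat{\otimes}\mathcal{B})$ is the continuous homomorphism determined by $a\otimes b\mapsto\sigma_{\mathcal{A}}(a)\otimes\sigma_{\mathcal{B}}(b)$. *)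

theory Defs
  imports "HOL-Analysis.Analysis"
begin

section \<open>Complex Banach spaces and Banach algebras\<close>

text \<open>
  The distribution only has type classes for real normed spaces and algebras. All Banach spaces and
  Banach algebras below are complex; Banach algebras are not assumed to have a unit. The real
  structure of each class is the one obtained by restriction of scalars.
\<close>

class complex_vector = real_vector +
  fixes scaleC :: "complex \<Rightarrow> 'a \<Rightarrow> 'a"  (infixr \<open>*\<^sub>C\<close> 75)
  assumes scaleC_add_right: "c *\<^sub>C (x + y) = c *\<^sub>C x + c *\<^sub>C y"
    and scaleC_add_left: "(c + d) *\<^sub>C x = c *\<^sub>C x + d *\<^sub>C x"
    and scaleC_scaleC: "c *\<^sub>C d *\<^sub>C x = (c * d) *\<^sub>C x"
    and scaleR_scaleC: "r *\<^sub>R x = complex_of_real r *\<^sub>C x"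

class complex_normed_vector = complex_vector + real_normed_vector +
  assumes norm_scaleC: "norm (c *\<^sub>C x) = cmod c * norm x"

class complex_banach = complex_normed_vector + banach

class complex_normed_algebra = complex_normed_vector + real_normed_algebra +
  assumes mult_scaleC_left: "(c *\<^sub>C x) * y = c *\<^sub>C (x * y)"
    and mult_scaleC_right: "x * (c *\<^sub>C y) = c *\<^sub>C (x * y)"

class complex_banach_algebra = complex_normed_algebra + complex_banach

lemma scaleC_one [simp]: "1 *\<^sub>C (x :: 'a::complex_vector) = x"
  using scaleR_scaleC[of 1 x] by simp

lemma scaleC_zero_right [simp]: "c *\<^sub>C (0 :: 'a::complex_vector) = 0"
  using scaleC_add_right[of c 0 "0::'a"] by simp

lemma scaleC_zero_left [simp]: "0 *\<^sub>C (x :: 'a::complex_vector) = 0"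
  using scaleC_add_left[of 0 0 x] by simp

lemma scaleC_minus_right: "c *\<^sub>C (- x) = - (c *\<^sub>C (x :: 'a::complex_vector))"
  using scaleC_add_right[of c x "- x"] by (simp add: eq_neg_iff_add_eq_0 add.commute)

lemma scaleC_diff_right: "c *\<^sub>C (x - y) = c *\<^sub>C x - c *\<^sub>C (y :: 'a::complex_vector)"
  using scaleC_add_right[of c x "- y"] by (simp add: scaleC_minus_right)

lemma scaleC_scaleR: "c *\<^sub>C r *\<^sub>R x = r *\<^sub>R c *\<^sub>C (x :: 'a::complex_vector)"
  by (simp add: scaleR_scaleC scaleC_scaleC mult.commute)

lemma bounded_linear_scaleC:
  "bounded_linear (\<lambda>x :: 'a::complex_normed_vector. c *\<^sub>C x)"
  by (rule bounded_linear_intro[of _ "cmod c"])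
    (simp_all add: scaleC_add_right scaleC_scaleR norm_scaleC mult.commute)

instantiation complex :: complex_banach_algebra
begin

definition scaleC_complex :: "complex \<Rightarrow> complex \<Rightarrow> complex"
  where "scaleC_complex c x = c * x"

instance
  by standard (simp_all add: scaleC_complex_def algebra_simps norm_mult scaleR_conv_of_real)

end


section \<open>Bounded complex-linear maps\<close>

definition bounded_clinear :: "('a::complex_normed_vector \<Rightarrow> 'b::complex_normed_vector) \<Rightarrow> bool"
  where "bounded_clinear f \<longleftrightarrow> bounded_linear f \<and> (\<forall>c x. f (c *\<^sub>C x) = c *\<^sub>C f x)"

lemma bounded_clinear_intro:
  assumes "\<And>x y. f (x + y) = f x + f y" "\<And>c x. f (c *\<^sub>C x) = c *\<^sub>C f x"
    "\<And>x. norm (f x) \<le> K * norm x"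
  shows "bounded_clinear f"
  unfolding bounded_clinear_def
  using assms by (auto simp: scaleR_scaleC mult.commute intro!: bounded_linear_intro[of f K])

typedef (overloaded) ('a, 'b) cblinfun (\<open>(_ \<Rightarrow>\<^sub>C\<^sub>L /_)\<close> [22, 21] 21) =
  "{f :: 'a::complex_normed_vector \<Rightarrow> 'b::complex_normed_vector. bounded_clinear f}"
  morphisms cblinfun_apply CBlinfun
  by (rule exI[of _ "\<lambda>_. 0"]) (simp add: bounded_clinear_def)

declare [[coercion
    "cblinfun_apply :: ('a::complex_normed_vector \<Rightarrow>\<^sub>C\<^sub>L 'b::complex_normed_vector) \<Rightarrow> 'a \<Rightarrow> 'b"]]

setup_lifting type_definition_cblinfun

lemma cblinfun_eqI: "(\<And>x. cblinfun_apply f x = cblinfun_apply g x) \<Longrightarrow> f = g"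
  by transfer auto

lemma CBlinfun_apply: "bounded_clinear f \<Longrightarrow> cblinfun_apply (CBlinfun f) = f"
  by (simp add: CBlinfun_inverse)

lemma bounded_clinear_apply: "bounded_clinear (cblinfun_apply f)"
  by transfer

lemma bounded_linear_cblinfun_apply: "bounded_linear (cblinfun_apply f)"
  using bounded_clinear_apply[of f] by (simp add: bounded_clinear_def)

instantiation cblinfun :: (complex_normed_vector, complex_normed_vector) complex_normed_vector
begin

lift_definition norm_cblinfun :: "'a \<Rightarrow>\<^sub>C\<^sub>L 'b \<Rightarrow> real" is onorm .

lift_definition minus_cblinfun :: "'a \<Rightarrow>\<^sub>C\<^sub>L 'b \<Rightarrow> 'a \<Rightarrow>\<^sub>C\<^sub>L 'b \<Rightarrow> 'a \<Rightarrow>\<^sub>C\<^sub>L 'b" is "\<lambda>f g x. f x - g x"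
  by (auto simp: bounded_clinear_def scaleC_diff_right intro: bounded_linear_sub)

definition dist_cblinfun :: "'a \<Rightarrow>\<^sub>C\<^sub>L 'b \<Rightarrow> 'a \<Rightarrow>\<^sub>C\<^sub>L 'b \<Rightarrow> real"
  where "dist_cblinfun f g = norm (f - g)"

definition [code del]:
  "(uniformity :: (('a \<Rightarrow>\<^sub>C\<^sub>L 'b) \<times> ('a \<Rightarrow>\<^sub>C\<^sub>L 'b)) filter) =
    (INF e\<in>{0 <..}. principal {(x, y). dist x y < e})"

definition open_cblinfun :: "('a \<Rightarrow>\<^sub>C\<^sub>L 'b) set \<Rightarrow> bool"
  where [code del]: "open_cblinfun S = (\<forall>x\<in>S. \<forall>\<^sub>F (x', y) in uniformity. x' = x \<longrightarrow> y \<in> S)"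

lift_definition uminus_cblinfun :: "'a \<Rightarrow>\<^sub>C\<^sub>L 'b \<Rightarrow> 'a \<Rightarrow>\<^sub>C\<^sub>L 'b" is "\<lambda>f x. - f x"
  by (auto simp: bounded_clinear_def scaleC_minus_right intro: bounded_linear_minus)

lift_definition zero_cblinfun :: "'a \<Rightarrow>\<^sub>C\<^sub>L 'b" is "\<lambda>x. 0"
  by (simp add: bounded_clinear_def)

lift_definition plus_cblinfun :: "'a \<Rightarrow>\<^sub>C\<^sub>L 'b \<Rightarrow> 'a \<Rightarrow>\<^sub>C\<^sub>L 'b \<Rightarrow> 'a \<Rightarrow>\<^sub>C\<^sub>L 'b" is "\<lambda>f g x. f x + g x"
  by (auto simp: bounded_clinear_def scaleC_add_right intro: bounded_linear_add)

lift_definition scaleR_cblinfun :: "real \<Rightarrow> 'a \<Rightarrow>\<^sub>C\<^sub>L 'b \<Rightarrow> 'a \<Rightarrow>\<^sub>C\<^sub>L 'b" is "\<lambda>r f x. r *\<^sub>R f x"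
  by (auto simp: bounded_clinear_def scaleC_scaleR
      intro: bounded_linear_compose[OF bounded_linear_scaleR_right])

lift_definition scaleC_cblinfun :: "complex \<Rightarrow> 'a \<Rightarrow>\<^sub>C\<^sub>L 'b \<Rightarrow> 'a \<Rightarrow>\<^sub>C\<^sub>L 'b" is "\<lambda>c f x. c *\<^sub>C f x"
  by (auto simp: bounded_clinear_def scaleC_scaleC mult.commute
      intro: bounded_linear_compose[OF bounded_linear_scaleC])

definition sgn_cblinfun :: "'a \<Rightarrow>\<^sub>C\<^sub>L 'b \<Rightarrow> 'a \<Rightarrow>\<^sub>C\<^sub>L 'b"
  where "sgn_cblinfun f = inverse (norm f) *\<^sub>R f"

lemma norm_cblinfun_bound_aux:
  fixes f :: "'a \<Rightarrow>\<^sub>C\<^sub>L 'b"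
  shows "0 \<le> K \<Longrightarrow> (\<And>x. norm (f x) \<le> K * norm x) \<Longrightarrow> norm f \<le> K"
  by transfer (rule onorm_bound)

lemma norm_cblinfun_aux: 
  fixes f :: "'a \<Rightarrow>\<^sub>C\<^sub>L 'b"
  shows "norm (f x) \<le> norm f * norm x" "0 \<le> norm f"
  by (transfer, simp add: bounded_clinear_def onorm onorm_pos_le)+

instance
proof
  fix f g :: "'a \<Rightarrow>\<^sub>C\<^sub>L 'b" and c :: complex
  show "(norm f = 0) = (f = 0)"
    by transfer (auto simp: bounded_clinear_def onorm_eq_0)
  show "norm (f + g) \<le> norm f + norm g"
    by transfer (auto simp: bounded_clinear_def onorm_triangle)
  show "norm (r *\<^sub>R f) = \<bar>r\<bar> * norm f" for r
    by transfer (auto simp: bounded_clinear_def onorm_scaleR)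
  have le: "norm (d *\<^sub>C h) \<le> cmod d * norm h" for d and h :: "'a \<Rightarrow>\<^sub>C\<^sub>L 'b"
  proof (rule norm_cblinfun_bound_aux)
    show "0 \<le> cmod d * norm h" by (simp add: norm_cblinfun_aux)
    show "norm ((d *\<^sub>C h) x) \<le> cmod d * norm h * norm x" for x
      using norm_cblinfun_aux(1)[of h x]
      by (simp add: scaleC_cblinfun.rep_eq norm_scaleC mult.assoc mult_left_mono)
  qed
  show "norm (c *\<^sub>C f) = cmod c * norm f"
  proof (cases "c = 0")
    case True
    then have "norm (c *\<^sub>C f) \<le> 0" using le[of c f] by simp
    then show ?thesis using True norm_cblinfun_aux(2)[of "c *\<^sub>C f"] by simp
  next
    case False
    have "f = inverse c *\<^sub>C c *\<^sub>C f"
      using False by transfer (simp add: scaleC_scaleC)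
    then have "norm f \<le> cmod (inverse c) * norm (c *\<^sub>C f)" using le by metis
    then have "cmod c * norm f \<le> norm (c *\<^sub>C f)"
      using False by (simp add: norm_inverse norm_divide field_simps)
    then show ?thesis using le[of c f] by simp
  qed
qed (unfold dist_cblinfun_def open_cblinfun_def sgn_cblinfun_def uniformity_cblinfun_def,
  (rule refl | (transfer, force simp: algebra_simps scaleC_add_right scaleC_add_left
      scaleC_scaleC scaleR_scaleC))+)

end

lemma norm_cblinfun: "norm (cblinfun_apply f x) \<le> norm f * norm x"
  by (rule norm_cblinfun_aux)

lemma norm_cblinfun_bound:
  "0 \<le> K \<Longrightarrow> (\<And>x. norm (cblinfun_apply f x) \<le> K * norm x) \<Longrightarrow> norm f \<le> K"
  by (rule norm_cblinfun_bound_aux)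

lemma bounded_bilinear_cblinfun_apply: "bounded_bilinear cblinfun_apply"
proof
  fix f g :: "'a \<Rightarrow>\<^sub>C\<^sub>L 'b" and x y :: 'a and r :: real
  show "(f + g) x = f x + g x" "(r *\<^sub>R f) x = r *\<^sub>R f x"
    by (transfer, simp)+
  interpret bounded_linear f by (rule bounded_linear_cblinfun_apply)
  show "f (x + y) = f x + f y" "f (r *\<^sub>R x) = r *\<^sub>R f x"
    by (simp_all add: add scaleR)
  show "\<exists>K. \<forall>f x. norm (cblinfun_apply f x) \<le> norm f * norm x * K"
    by (auto intro!: exI[where x=1] norm_cblinfun)
qed

interpretation cblinfun: bounded_bilinear cblinfun_apply
  by (rule bounded_bilinear_cblinfun_apply)

declare cblinfun.zero_left [simp] cblinfun.zero_right [simp]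

lemma cblinfun_scaleC_left: "cblinfun_apply (c *\<^sub>C f) x = c *\<^sub>C cblinfun_apply f x"
  by transfer simp

lemma cblinfun_scaleC_right: "cblinfun_apply f (c *\<^sub>C x) = c *\<^sub>C cblinfun_apply f x"
  by transfer (simp add: bounded_clinear_def)

lemmas cblinfun_simps = cblinfun.bilinear_simps cblinfun_scaleC_left cblinfun_scaleC_right

instance cblinfun :: (complex_normed_vector, complex_banach) complex_banach
proof
  fix X :: "nat \<Rightarrow> 'a \<Rightarrow>\<^sub>C\<^sub>L 'b"
  assume X: "Cauchy X"
  define B where "B f = Blinfun (cblinfun_apply f)" for f :: "'a \<Rightarrow>\<^sub>C\<^sub>L 'b"
  have B_apply: "blinfun_apply (B f) = cblinfun_apply f" for f
    by (simp add: B_def bounded_linear_Blinfun_apply bounded_linear_cblinfun_apply)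
  have norm_B: "norm (B f - B g) = norm (f - g)" for f g
    by (simp add: norm_blinfun.rep_eq norm_cblinfun.rep_eq minus_blinfun.rep_eq
        minus_cblinfun.rep_eq B_apply)
  have "Cauchy (\<lambda>n. B (X n))"
    using X by (simp add: Cauchy_iff norm_B)
  then obtain L where L: "(\<lambda>n. B (X n)) \<longlonglongrightarrow> L"
    using Cauchy_convergent_iff convergent_def by blast
  have lim: "(\<lambda>n. X n x) \<longlonglongrightarrow> L x" for x
    using blinfun.tendsto[OF L tendsto_const[of x]] by (simp add: B_apply)
  have "L (c *\<^sub>C x) = c *\<^sub>C L x" for c x
  proof (rule LIMSEQ_unique)
    show "(\<lambda>n. X n (c *\<^sub>C x)) \<longlonglongrightarrow> L (c *\<^sub>C x)" by (rule lim)
    show "(\<lambda>n. X n (c *\<^sub>C x)) \<longlonglongrightarrow> c *\<^sub>C L x"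
      unfolding cblinfun_scaleC_right
      by (rule bounded_linear.tendsto[OF bounded_linear_scaleC lim])
  qed
  then have "bounded_clinear (blinfun_apply L)"
    by (simp add: bounded_clinear_def blinfun.bounded_linear_right)
  then have "B (CBlinfun L) = L"
    by (intro blinfun_eqI) (simp add: B_apply CBlinfun_apply)
  then have "X \<longlonglongrightarrow> CBlinfun L"
    using L unfolding LIMSEQ_iff by (metis norm_B)
  then show "convergent X" by (rule convergentI)
qed

lift_definition cblinfun_compose ::
    "('b::complex_normed_vector \<Rightarrow>\<^sub>C\<^sub>L 'c::complex_normed_vector) \<Rightarrow>
      ('a::complex_normed_vector \<Rightarrow>\<^sub>C\<^sub>L 'b) \<Rightarrow> ('a \<Rightarrow>\<^sub>C\<^sub>L 'c)"  (infixl \<open>o\<^sub>C\<close> 55)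
  is "\<lambda>g f x. g (f x)"
  by (auto simp: bounded_clinear_def intro: bounded_linear_compose)

lift_definition cblinfun_id :: "'a::complex_normed_vector \<Rightarrow>\<^sub>C\<^sub>L 'a" is "\<lambda>x. x"
  by (simp add: bounded_clinear_def)

declare cblinfun_compose.rep_eq [simp] cblinfun_id.rep_eq [simp]

text \<open>A bounded bilinear map is the same thing as an element of \<open>'a \<Rightarrow>\<^sub>C\<^sub>L 'b \<Rightarrow>\<^sub>C\<^sub>L 'c\<close>.\<close>

definition cbilinear ::
    "('a::complex_normed_vector \<Rightarrow> 'b::complex_normed_vector \<Rightarrow> 'c::complex_normed_vector)
      \<Rightarrow> ('a \<Rightarrow>\<^sub>C\<^sub>L 'b \<Rightarrow>\<^sub>C\<^sub>L 'c)"
  where "cbilinear f = CBlinfun (\<lambda>x. CBlinfun (f x))"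

definition bounded_cbilinear ::
    "('a::complex_normed_vector \<Rightarrow> 'b::complex_normed_vector \<Rightarrow> 'c::complex_normed_vector) \<Rightarrow> bool"
  where "bounded_cbilinear f \<longleftrightarrow>
    (\<forall>x x' y. f (x + x') y = f x y + f x' y) \<and> (\<forall>x y y'. f x (y + y') = f x y + f x y') \<and>
    (\<forall>c x y. f (c *\<^sub>C x) y = c *\<^sub>C f x y) \<and> (\<forall>c x y. f x (c *\<^sub>C y) = c *\<^sub>C f x y) \<and>
    (\<exists>K. \<forall>x y. norm (f x y) \<le> K * norm x * norm y)"

lemma bounded_cbilinear_intro:
  assumes "\<And>x x' y. f (x + x') y = f x y + f x' y" "\<And>x y y'. f x (y + y') = f x y + f x y'"
    "\<And>c x y. f (c *\<^sub>C x) y = c *\<^sub>C f x y" "\<And>c x y. f x (c *\<^sub>C y) = c *\<^sub>C f x y"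
    "\<And>x y. norm (f x y) \<le> K * norm x * norm y"
  shows "bounded_cbilinear f"
  unfolding bounded_cbilinear_def using assms by blast

lemma cbilinear_apply:
  assumes "bounded_cbilinear f"
  shows "cblinfun_apply (cblinfun_apply (cbilinear f) x) y = f x y"
proof -
  obtain K where K: "\<And>x y. norm (f x y) \<le> K * norm x * norm y"
    and f: "\<And>x x' y. f (x + x') y = f x y + f x' y" "\<And>x y y'. f x (y + y') = f x y + f x y'"
      "\<And>c x y. f (c *\<^sub>C x) y = c *\<^sub>C f x y" "\<And>c x y. f x (c *\<^sub>C y) = c *\<^sub>C f x y"
    using assms unfolding bounded_cbilinear_def by blast
  have 1: "bounded_clinear (f x)" for x
    by (rule bounded_clinear_intro[of _ "K * norm x"]) (use f K in auto)
  have "bounded_clinear (\<lambda>x. CBlinfun (f x))"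
  proof (rule bounded_clinear_intro[of _ "\<bar>K\<bar>"])
    show "CBlinfun (f (x + y)) = CBlinfun (f x) + CBlinfun (f y)" for x y
      by (rule cblinfun_eqI) (simp add: CBlinfun_apply 1 f plus_cblinfun.rep_eq)
    show "CBlinfun (f (c *\<^sub>C x)) = c *\<^sub>C CBlinfun (f x)" for c x
      by (rule cblinfun_eqI) (simp add: CBlinfun_apply 1 f scaleC_cblinfun.rep_eq)
    show "norm (CBlinfun (f x)) \<le> \<bar>K\<bar> * norm x" for x
    proof (rule norm_cblinfun_bound)
      show "norm (CBlinfun (f x) y) \<le> \<bar>K\<bar> * norm x * norm y" for y
        using K[of x y] by (simp add: CBlinfun_apply 1)
          (meson abs_ge_self mult_right_mono norm_ge_zero order_trans)
    qed simp
  qed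
  then show ?thesis by (simp add: cbilinear_def CBlinfun_apply 1)
qed


section \<open>Hahn--Banach: bounded functionals separate points\<close>

definition sublinear :: "('a::real_vector \<Rightarrow> real) \<Rightarrow> bool"
  where "sublinear q \<longleftrightarrow>
    (\<forall>x y. q (x + y) \<le> q x + q y) \<and> (\<forall>r x. 0 \<le> r \<longrightarrow> q (r *\<^sub>R x) = r * q x)"

lemma sublinear_lower: "sublinear q \<Longrightarrow> - q (- x) \<le> q x"
proof -
  assume q: "sublinear q"
  have "q 0 = 0" using q unfolding sublinear_def by (metis mult_zero_left order_refl scaleR_zero_left)
  moreover have "q (x + (- x)) \<le> q x + q (- x)" using q unfolding sublinear_def by blast
  ultimately show ?thesis by simp
qed

lemma sublinear_shrink:
  fixes q :: "'a::real_vector \<Rightarrow> real"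
  assumes q: "sublinear q"
  obtains q' where "sublinear q'" "\<And>x. q' x \<le> q x" "\<And>x. q' x \<le> q (x + y) - q y"
proof -
  have add: "q (x + z) \<le> q x + q z" and hom: "0 \<le> r \<Longrightarrow> q (r *\<^sub>R x) = r * q x" for x z r
    using q by (auto simp: sublinear_def)
  define S where "S x = (\<lambda>t. q (x + t *\<^sub>R y) - t * q y) ` {0..}" for x
  define q' where "q' x = Inf (S x)" for x
  have ne: "S x \<noteq> {}" for x by (auto simp: S_def)
  have bdd: "bdd_below (S x)" for x
  proof (rule bdd_belowI)
    fix s assume "s \<in> S x"
    then obtain t where t: "0 \<le> t" "s = q (x + t *\<^sub>R y) - t * q y" by (auto simp: S_def)
    have "q (t *\<^sub>R y) \<le> q (x + t *\<^sub>R y) + q (- x)"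
      using add[of "x + t *\<^sub>R y" "- x"] by simp
    then show "- q (- x) \<le> s" using t hom by simp
  qed
  have le: "q' x \<le> q (x + t *\<^sub>R y) - t * q y" if "0 \<le> t" for x t
    unfolding q'_def using that by (intro cInf_lower bdd) (auto simp: S_def)
  have ge: "c \<le> q' x" if "\<And>t. 0 \<le> t \<Longrightarrow> c \<le> q (x + t *\<^sub>R y) - t * q y" for c x
    unfolding q'_def using that by (intro cInf_greatest ne) (auto simp: S_def)
  have hom_le: "q' (r *\<^sub>R x) \<le> r * q' x" if "0 < r" for r x
  proof -
    have "q' (r *\<^sub>R x) / r \<le> q' x"
    proof (rule ge)
      fix t :: real assume t: "0 \<le> t"
      have "q' (r *\<^sub>R x) \<le> q (r *\<^sub>R x + (r * t) *\<^sub>R y) - r * t * q y"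
        using t that by (intro le) simp
      also have "r *\<^sub>R x + (r * t) *\<^sub>R y = r *\<^sub>R (x + t *\<^sub>R y)"
        by (simp add: scaleR_add_right)
      also have "q \<dots> - r * t * q y = r * (q (x + t *\<^sub>R y) - t * q y)"
        using that hom[of r "x + t *\<^sub>R y"] by (simp add: right_diff_distrib)
      finally show "q' (r *\<^sub>R x) / r \<le> q (x + t *\<^sub>R y) - t * q y"
        using that by (simp add: field_simps)
    qed
    then show ?thesis using that by (simp add: field_simps)
  qed
  have "sublinear q'"
    unfolding sublinear_def
  proof (intro conjI allI impI)
    fix x z
    have "q' (x + z) - (q (z + u *\<^sub>R y) - u * q y) \<le> q' x" if u: "0 \<le> u" for u
    proof (rule ge)
      fix t :: real assume t: "0 \<le> t"
      have "q' (x + z) \<le> q (x + z + (t + u) *\<^sub>R y) - (t + u) * q y"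
        using t u by (intro le) simp
      also have "x + z + (t + u) *\<^sub>R y = (x + t *\<^sub>R y) + (z + u *\<^sub>R y)"
        by (simp add: scaleR_add_left)
      also have "q \<dots> \<le> q (x + t *\<^sub>R y) + q (z + u *\<^sub>R y)" by (rule add)
      finally show "q' (x + z) - (q (z + u *\<^sub>R y) - u * q y) \<le> q (x + t *\<^sub>R y) - t * q y"
        by (simp add: algebra_simps)
    qed
    then have "q' (x + z) - q' x \<le> q' z" by (intro ge) (simp add: algebra_simps)
    then show "q' (x + z) \<le> q' x + q' z" by simp
  next
    fix r :: real and x assume "0 \<le> r"
    show "q' (r *\<^sub>R x) = r * q' x"
    proof (cases "r = 0")
      case True
      have "q 0 = 0" using hom[of 0 0] by simp
      then have "0 \<le> q' 0" by (intro ge) (simp add: hom)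
      moreover have "q' 0 \<le> 0" using le[of 0 0] \<open>q 0 = 0\<close> by simp
      ultimately show ?thesis using True by simp
    next
      case False
      then have r: "0 < r" using \<open>0 \<le> r\<close> by simp
      have "q' (inverse r *\<^sub>R r *\<^sub>R x) \<le> inverse r * q' (r *\<^sub>R x)"
        using r by (intro hom_le) simp
      then have "r * q' x \<le> q' (r *\<^sub>R x)" using r by (simp add: field_simps)
      then show ?thesis using hom_le[OF r, of x] by simp
    qed
  qed
  moreover have "q' x \<le> q x" for x using le[of 0 x] by simp
  moreover have "q' x \<le> q (x + y) - q y" for x using le[of 1 x] by simp
  ultimately show ?thesis using that by blast
qed

lemma sublinear_minimal:
  fixes p :: "'a::real_vector \<Rightarrow> real"
  assumes p: "sublinear p"
  obtains f where "sublinear f" "\<And>x. f x \<le> p x" "\<And>x y. f (x + y) = f x + f y"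
proof -
  define A where "A = {q. sublinear q \<and> (\<forall>x. q x \<le> p x)}"
  define P where "P f g \<longleftrightarrow> (\<forall>x. g x \<le> f x)" for f g :: "'a \<Rightarrow> real"
  have po: "partial_order_on A (relation_of P A)"
    by (rule partial_order_on_relation_ofI) (auto simp: P_def intro: order_trans intro!: ext antisym)
  have "\<exists>m\<in>A. \<forall>a\<in>A. P m a \<longrightarrow> a = m"
  proof (rule predicate_Zorn[OF po])
    fix C assume C: "C \<in> Chains (relation_of P A)"
    show "\<exists>u\<in>A. \<forall>a\<in>C. P a u"
    proof (cases "C = {}")
      case True
      then show ?thesis using p by (auto simp: A_def)
    next
      case False
      have CA: "a \<in> A" if "a \<in> C" for a
        using C that by (auto simp: Chains_def relation_of_def)
      have tot: "P a b \<or> P b a" if "a \<in> C" "b \<in> C" for a b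
        using C that by (auto simp: Chains_def relation_of_def)
      define u where "u x = (INF a\<in>C. a x)" for x
      have bdd: "bdd_below ((\<lambda>a. a x) ` C)" for x
      proof (rule bdd_belowI2)
        fix a assume "a \<in> C"
        then have a: "sublinear a" "a (- x) \<le> p (- x)" using CA by (auto simp: A_def)
        then show "- p (- x) \<le> a x" using sublinear_lower[OF a(1), of x] by simp
      qed
      have le: "u x \<le> a x" if "a \<in> C" for a x
        unfolding u_def by (rule cINF_lower[OF bdd that])
      have ge: "c \<le> u x" if "\<And>a. a \<in> C \<Longrightarrow> c \<le> a x" for c x
        unfolding u_def using that by (rule cINF_greatest[OF False])
      have "sublinear u"
        unfolding sublinear_def
      proof (intro conjI allI impI)
        fix x y
        have "u (x + y) - b y \<le> u x" if b: "b \<in> C" for b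
        proof (rule ge)
          fix a assume a: "a \<in> C"
          obtain c where c: "c \<in> C" "c x \<le> a x" "c y \<le> b y"
            using tot[OF a b] a b by (auto simp: P_def)
          have "u (x + y) \<le> c (x + y)" by (rule le[OF c(1)])
          also have "\<dots> \<le> c x + c y" using CA[OF c(1)] by (auto simp: A_def sublinear_def)
          finally show "u (x + y) - b y \<le> a x" using c by simp
        qed
        then have "u (x + y) - u x \<le> u y" by (intro ge) (simp add: algebra_simps)
        then show "u (x + y) \<le> u x + u y" by simp
      next
        fix r :: real and x assume r: "0 \<le> r"
        have hom: "a (r *\<^sub>R x) = r * a x" if "a \<in> C" for a
          using CA[OF that] r by (auto simp: A_def sublinear_def)
        have "u (r *\<^sub>R x) / r \<le> u x" if "r \<noteq> 0"
          using that r le hom by (intro ge) (force simp: field_simps)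
        moreover have "r * u x \<le> u (r *\<^sub>R x)"
          proof (rule ge)
          fix a assume "a \<in> C"
          then show "r * u x \<le> a (r *\<^sub>R x)" using mult_left_mono[OF le r, of a x] hom by simp
        qed
        moreover have "u (0 *\<^sub>R x) = 0" if "r = 0"
        proof -
          have "(\<lambda>a. a (0 :: 'a)) ` C = {0}" using hom False that by (auto simp: image_iff)
          then show ?thesis by (simp add: u_def)
        qed
        ultimately show "u (r *\<^sub>R x) = r * u x"
          using r by (cases "r = 0") (auto simp: field_simps)
      qed
      moreover have "u x \<le> p x" for x
        using False le CA unfolding A_def by (metis (mono_tags, lifting) all_not_in_conv mem_Collect_eq order_trans)
      ultimately show ?thesis using le by (auto simp: A_def P_def)
    qed
  qed
  then obtain f where f: "f \<in> A" and min: "\<And>g. g \<in> A \<Longrightarrow> P f g \<Longrightarrow> g = f" by blast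
  have sub: "sublinear f" and fp: "\<And>x. f x \<le> p x" using f by (auto simp: A_def)
  have "f (x + y) = f x + f y" for x y
  proof (rule antisym)
    show "f (x + y) \<le> f x + f y" using sub by (simp add: sublinear_def)
    obtain g where g: "sublinear g" "\<And>x. g x \<le> f x" "\<And>x. g x \<le> f (x + y) - f y"
      using sublinear_shrink[OF sub, of y] by metis
    have "g \<in> A" using g fp by (auto simp: A_def intro: order_trans)
    then have "g = f" using g by (intro min) (auto simp: P_def)
    then show "f x + f y \<le> f (x + y)" using g(3)[of x] by simp
  qed
  then show ?thesis using that sub fp by blast
qed

lemma real_Hahn_Banach:
  fixes x0 :: "'a::real_normed_vector"
  obtains f where "linear f" "\<And>x. f x \<le> norm x" "f x0 = norm x0"
proof -
  have "sublinear (norm :: 'a \<Rightarrow> real)" by (auto simp: sublinear_def norm_triangle_ineq)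
  then obtain q where q: "sublinear q" "\<And>x. q x \<le> norm x" "\<And>x. q x \<le> norm (x + x0) - norm x0"
    using sublinear_shrink[of norm x0] by metis
  obtain f where f: "sublinear f" "\<And>x. f x \<le> q x" "\<And>x y. f (x + y) = f x + f y"
    using sublinear_minimal[OF q(1)] by metis
  have le: "f x \<le> norm x" for x using f(2) q(2) order_trans by blast
  have f0: "f 0 = 0" using f(3)[of 0 0] by simp
  have neg: "f (- x) = - f x" for x using f(3)[of x "- x"] f0 by simp
  have "linear f"
  proof (rule linearI)
    show "f (x + y) = f x + f y" for x y by (rule f)
    show "f (r *\<^sub>R x) = r *\<^sub>R f x" for r x
    proof (cases "0 \<le> r")
      case True
      then show ?thesis using f(1) by (simp add: sublinear_def)
    next
      case False
      have hom: "0 \<le> s \<Longrightarrow> f (s *\<^sub>R x) = s * f x" for s using f(1) by (simp add: sublinear_def)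
      have "f ((- r) *\<^sub>R x) = (- r) * f x" using False by (intro hom) simp
      then show ?thesis using neg[of "r *\<^sub>R x"] by simp
    qed
  qed
  moreover have "f x0 = norm x0"
  proof (rule antisym)
    have "f (- x0) \<le> - norm x0" using f(2)[of "- x0"] q(3)[of "- x0"] by simp
    then show "norm x0 \<le> f x0" using neg by simp
  qed (rule le)
  ultimately show ?thesis using that le by blast
qed

theorem complex_Hahn_Banach:
  fixes x0 :: "'a::complex_normed_vector"
  obtains \<phi> :: "'a \<Rightarrow>\<^sub>C\<^sub>L complex" where "norm \<phi> \<le> 1" "\<phi> x0 = of_real (norm x0)"
proof -
  obtain f :: "'a \<Rightarrow> real" where f: "linear f" "\<And>x. f x \<le> norm x" "f x0 = norm x0"
    using real_Hahn_Banach by metis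
  interpret linear f by (rule f)
  define F where "F x = Complex (f x) (- f (\<i> *\<^sub>C x))" for x
  have I: "f (\<i> *\<^sub>C \<i> *\<^sub>C x) = - f x" for x
    using scaleR_scaleC[of "-1" x, symmetric] by (simp add: scaleC_scaleC neg)
  have CD: "c *\<^sub>C x = Re c *\<^sub>R x + Im c *\<^sub>R \<i> *\<^sub>C x" for c and x :: 'a
  proof -
    have "Re c *\<^sub>R x + Im c *\<^sub>R \<i> *\<^sub>C x = (of_real (Re c) + of_real (Im c) * \<i>) *\<^sub>C x"
      by (simp add: scaleR_scaleC scaleC_scaleC scaleC_add_left)
    then show ?thesis by (metis complex_eq mult.commute)
  qed
  have F_add: "F (x + y) = F x + F y" for x y
    by (simp add: F_def add scaleC_add_right complex_eq_iff)
  have F_scale: "F (c *\<^sub>C x) = c *\<^sub>C F x" for c x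
  proof -
    have "\<i> *\<^sub>C c *\<^sub>C x = Re c *\<^sub>R \<i> *\<^sub>C x + Im c *\<^sub>R \<i> *\<^sub>C \<i> *\<^sub>C x"
      by (subst CD[of c]) (simp add: scaleC_add_right scaleC_scaleR)
    then have "f (\<i> *\<^sub>C c *\<^sub>C x) = Re c * f (\<i> *\<^sub>C x) - Im c * f x"
      by (simp add: add scale I)
    moreover have "f (c *\<^sub>C x) = Re c * f x + Im c * f (\<i> *\<^sub>C x)"
      by (subst CD[of c]) (simp add: add scale)
    ultimately show ?thesis by (simp add: F_def scaleC_complex_def complex_eq_iff algebra_simps)
  qed
  have F_norm: "norm (F x) \<le> norm x" for x
  proof (cases "F x = 0")
    case False
    define c where "c = cnj (F x) / cmod (F x)"
    have c: "cmod c = 1" using False by (simp add: c_def norm_divide)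
    have "F (c *\<^sub>C x) = cmod (F x)"
      using False by (simp add: F_scale scaleC_complex_def c_def complex_norm_square[symmetric]
          power2_eq_square mult.commute)
    then have "cmod (F x) = f (c *\<^sub>C x)" by (simp add: F_def complex_eq_iff)
    also have "\<dots> \<le> norm (c *\<^sub>C x)" by (rule f)
    finally show ?thesis by (simp add: norm_scaleC c)
  qed simp
  have F: "bounded_clinear F"
    by (rule bounded_clinear_intro[of _ 1]) (use F_add F_scale F_norm in auto)
  have "norm (CBlinfun F) \<le> 1"
    by (rule norm_cblinfun_bound) (simp_all add: CBlinfun_apply F F_norm)
  moreover have "CBlinfun F x0 = of_real (norm x0)"
  proof -
    have Re: "Re (F x0) = norm x0" by (simp add: F_def f)
    have "(cmod (F x0))\<^sup>2 \<le> (norm x0)\<^sup>2" using F_norm[of x0] by (rule power_mono) simp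
    then have "Im (F x0) = 0" using cmod_power2[of "F x0"] Re by simp
    then show ?thesis using Re by (simp add: CBlinfun_apply F complex_eq_iff)
  qed
  ultimately show ?thesis using that by blast
qed

lemma functionals_separate:
  fixes x y :: "'a::complex_normed_vector"
  assumes "\<And>\<phi> :: 'a \<Rightarrow>\<^sub>C\<^sub>L complex. \<phi> x = \<phi> y"
  shows "x = y"
proof -
  obtain \<phi> :: "'a \<Rightarrow>\<^sub>C\<^sub>L complex" where "\<phi> (x - y) = of_real (norm (x - y))"
    using complex_Hahn_Banach by metis
  then show ?thesis using assms[of \<phi>] by (simp add: cblinfun_simps)
qed


section \<open>The projective tensor product\<close>

lemma double_series:
  fixes f :: "nat \<Rightarrow> nat \<Rightarrow> 'a::banach"
  assumes inner: "\<And>k. summable (\<lambda>n. norm (f k n))"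
    and outer: "summable (\<lambda>k. \<Sum>n. norm (f k n))"
  defines "g \<equiv> \<lambda>m. f (fst (prod_decode m)) (snd (prod_decode m))"
  shows "summable (\<lambda>m. norm (g m))" "(\<lambda>k. \<Sum>n. f k n) sums (\<Sum>m. g m)"
proof -
  have nat: "infsum h UNIV = suminf h" if "summable (\<lambda>n. norm (h n))" for h :: "nat \<Rightarrow> 'c::banach"
    using norm_summable_imp_has_sum[OF that summable_sums[OF summable_norm_cancel[OF that]]]
    by (rule infsumI)
  have nn: "0 \<le> (\<Sum>n. norm (f k n))" for k using inner by (intro suminf_nonneg) auto
  have inner': "(\<lambda>n. norm (f k n)) summable_on UNIV" for k
    using inner by (subst summable_on_UNIV_nonneg_real_iff) auto
  have "(\<lambda>k. \<Sum>\<^sub>\<infinity>n. norm (f k n)) summable_on UNIV"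
    using outer nn by (subst nat) (auto simp: inner summable_on_UNIV_nonneg_real_iff)
  then have abs: "(\<lambda>p. norm (case p of (k, n) \<Rightarrow> f k n)) summable_on UNIV \<times> UNIV"
    using inner' by (intro Infinite_Sum.abs_summable_on_Sigma_iff[THEN iffD2])
      (auto simp: infsum_nonneg)
  have bij: "bij_betw prod_decode UNIV (UNIV \<times> UNIV)"
    by (simp add: bij_prod_decode)
  have g: "g m = (case prod_decode m of (k, n) \<Rightarrow> f k n)" for m
    by (simp add: g_def split_beta)
  have "(\<lambda>m. norm (g m)) summable_on UNIV"
    using abs summable_on_reindex_bij_betw[OF bij, of "\<lambda>p. norm (case p of (k, n) \<Rightarrow> f k n)"]
    by (simp add: g)
  then show *: "summable (\<lambda>m. norm (g m))"
    by (subst (asm) summable_on_UNIV_nonneg_real_iff) auto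
  have s: "(\<lambda>(k, n). f k n) summable_on UNIV \<times> UNIV"
    using abs by (rule abs_summable_summable)
  have i: "(\<Sum>\<^sub>\<infinity>n. f k n) = (\<Sum>n. f k n)" for k using nat[OF inner] .
  have "(\<lambda>k. \<Sum>\<^sub>\<infinity>n. f k n) summable_on UNIV"
    using s by (rule summable_on_Sigma_banach)
  then have "(\<lambda>k. \<Sum>n. f k n) sums (\<Sum>\<^sub>\<infinity>k. \<Sum>n. f k n)"
    by (intro has_sum_imp_sums) (simp add: i)
  also have "(\<Sum>\<^sub>\<infinity>k. \<Sum>n. f k n) = (\<Sum>\<^sub>\<infinity>(k, n)\<in>UNIV \<times> UNIV. f k n)"
    using infsum_Sigma'_banach[OF s] by (simp add: i)
  also have "\<dots> = (\<Sum>\<^sub>\<infinity>m. g m)"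
    using infsum_reindex_bij_betw[OF bij, of "\<lambda>(k, n). f k n"] by (simp add: g)
  also have "\<dots> = (\<Sum>m. g m)" using nat[OF *] .
  finally show "(\<lambda>k. \<Sum>n. f k n) sums (\<Sum>m. g m)" .
qed

text \<open>
  An element of the projective tensor product of \<open>'a\<close> and \<open>'b\<close> is a series
  \<open>\<Sum>n. a n \<otimes> b n\<close> with \<open>(\<Sum>n. norm (a n) * norm (b n)) < \<infinity>\<close>, where two series are identified iff
  all bounded bilinear forms agree on them; its norm is the infimum of
  \<open>\<Sum>n. norm (a n) * norm (b n)\<close> over all the series that represent it. By a theorem of
  Grothendieck this is the completion of the algebraic tensor product in the projective norm.
  The lemmas \<open>norm_tensor\<close>, \<open>ptensor_sums\<close>, \<open>ptensor_universal\<close> and \<open>norm_ptensor_bound\<close>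
  below show that it is a Banach space with \<open>norm (a \<otimes> b) = norm a * norm b\<close>, that it is the closed
  span of the elementary tensors, and that every bounded bilinear map into a Banach space factors
  through it, uniquely and with the same norm; this determines it up to isometric isomorphism.
\<close>

definition represents ::
    "(nat \<Rightarrow> 'a::complex_normed_vector) \<Rightarrow> (nat \<Rightarrow> 'b::complex_normed_vector) \<Rightarrow>
      (('a \<Rightarrow>\<^sub>C\<^sub>L 'b \<Rightarrow>\<^sub>C\<^sub>L complex) \<Rightarrow>\<^sub>C\<^sub>L complex) \<Rightarrow> bool"
  where "represents a b u \<longleftrightarrow>
    summable (\<lambda>n. norm (a n) * norm (b n)) \<and> (\<forall>\<beta>. u \<beta> = (\<Sum>n. \<beta> (a n) (b n)))"

lemma represents_zero: "represents (\<lambda>_. 0) (\<lambda>_. 0) 0"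
  by (simp add: represents_def)

typedef (overloaded) ('a, 'b) ptensor (infixr \<open>\<otimes>\<^sub>\<pi>\<close> 70) =
  "{u :: ('a::complex_normed_vector \<Rightarrow>\<^sub>C\<^sub>L 'b::complex_normed_vector \<Rightarrow>\<^sub>C\<^sub>L complex) \<Rightarrow>\<^sub>C\<^sub>L complex.
    \<exists>a b. represents a b u}"
  using represents_zero by blast

setup_lifting type_definition_ptensor

lemma bilinear_form_bound:
  "norm (cblinfun_apply (cblinfun_apply \<beta> x) y) \<le> norm \<beta> * (norm x * norm y)"
proof -
  have "norm (\<beta> x y) \<le> norm (\<beta> x) * norm y" by (rule norm_cblinfun)
  also have "\<dots> \<le> norm \<beta> * norm x * norm y" by (intro mult_right_mono norm_cblinfun) simp
  finally show ?thesis by (simp add: mult.assoc)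
qed

lemma summable_bilinear_form:
  assumes "summable (\<lambda>n. norm (a n) * norm (b n))"
  shows "summable (\<lambda>n. norm (cblinfun_apply (cblinfun_apply \<beta> (a n)) (b n)))"
  by (rule summable_comparison_test'[OF summable_mult[OF assms, of "norm \<beta>"], of 0])
    (simp add: bilinear_form_bound)

lemma suminf_bilinear_form_bound:
  fixes \<beta> :: "'a::complex_normed_vector \<Rightarrow>\<^sub>C\<^sub>L 'b::complex_normed_vector \<Rightarrow>\<^sub>C\<^sub>L 'c::complex_banach"
  assumes "summable (\<lambda>n. norm (a n) * norm (b n))"
  shows "norm (\<Sum>n. cblinfun_apply (cblinfun_apply \<beta> (a n)) (b n))
    \<le> norm \<beta> * (\<Sum>n. norm (a n) * norm (b n))"
proof -
  have "norm (\<Sum>n. \<beta> (a n) (b n)) \<le> (\<Sum>n. norm (\<beta> (a n) (b n)))"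
    using summable_bilinear_form[OF assms] by (rule summable_norm)
  also have "\<dots> \<le> (\<Sum>n. norm \<beta> * (norm (a n) * norm (b n)))"
    by (intro suminf_le summable_bilinear_form summable_mult assms bilinear_form_bound)
  also have "\<dots> = norm \<beta> * (\<Sum>n. norm (a n) * norm (b n))"
    using assms by (rule suminf_mult)
  finally show ?thesis .
qed

lemma represents_exists:
  fixes a :: "nat \<Rightarrow> 'a::complex_normed_vector" and b :: "nat \<Rightarrow> 'b::complex_normed_vector"
  assumes ab: "summable (\<lambda>n. norm (a n) * norm (b n))"
  obtains u where "represents a b u"
proof -
  note s = summable_norm_cancel[OF summable_bilinear_form[OF ab]]
  define U where "U \<beta> = (\<Sum>n. \<beta> (a n) (b n))" for \<beta> :: "'a \<Rightarrow>\<^sub>C\<^sub>L 'b \<Rightarrow>\<^sub>C\<^sub>L complex"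
  have "bounded_clinear U"
  proof (rule bounded_clinear_intro)
    show "U (\<beta> + \<gamma>) = U \<beta> + U \<gamma>" for \<beta> \<gamma>
      using suminf_add[OF s s, of \<beta> \<gamma>] by (simp add: U_def cblinfun_simps)
    show "U (c *\<^sub>C \<beta>) = c *\<^sub>C U \<beta>" for c \<beta>
      using suminf_mult[OF s, of c \<beta>] by (simp add: U_def cblinfun_simps scaleC_complex_def)
    show "norm (U \<beta>) \<le> (\<Sum>n. norm (a n) * norm (b n)) * norm \<beta>" for \<beta>
      using suminf_bilinear_form_bound[OF ab, of \<beta>] by (simp add: U_def mult.commute)
  qed
  then have "represents a b (CBlinfun U)"
    by (simp add: represents_def ab CBlinfun_apply U_def)
  then show ?thesis by (rule that)
qed

lemma represents_double:
  assumes rep: "\<And>k. represents (a k) (b k) (u k)"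
    and sum: "summable (\<lambda>k. \<Sum>n. norm (a k n) * norm (b k n))"
  obtains a' b' v where "represents a' b' v"
    "(\<Sum>n. norm (a' n) * norm (b' n)) = (\<Sum>k. \<Sum>n. norm (a k n) * norm (b k n))"
    "\<And>\<beta>. (\<lambda>k. cblinfun_apply (u k) \<beta>) sums cblinfun_apply v \<beta>"
proof -
  define d where "d m = prod_decode m" for m
  define a' where "a' m = a (fst (d m)) (snd (d m))" for m
  define b' where "b' m = b (fst (d m)) (snd (d m))" for m
  have s: "summable (\<lambda>n. norm (a k n) * norm (b k n))" for k
    using rep by (simp add: represents_def)
  have 1: "summable (\<lambda>m. norm (a' m) * norm (b' m))"
    "(\<Sum>n. norm (a' n) * norm (b' n)) = (\<Sum>k. \<Sum>n. norm (a k n) * norm (b k n))"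
    using double_series[of "\<lambda>k n. norm (a k n) * norm (b k n)"] s sum
    by (auto simp: a'_def b'_def d_def sums_iff)
  obtain v where v: "represents a' b' v" using represents_exists[OF 1(1)] .
  have "(\<lambda>k. u k \<beta>) sums v \<beta>" for \<beta>
  proof -
    have "summable (\<lambda>k. \<Sum>n. norm (\<beta> (a k n) (b k n)))"
    proof (rule summable_comparison_test'[OF summable_mult[OF sum, of "norm \<beta>"], of 0])
      fix k
      have "(\<Sum>n. norm (\<beta> (a k n) (b k n))) \<le> (\<Sum>n. norm \<beta> * (norm (a k n) * norm (b k n)))"
        by (intro suminf_le summable_bilinear_form summable_mult s bilinear_form_bound)
      also have "\<dots> = norm \<beta> * (\<Sum>n. norm (a k n) * norm (b k n))"
        using s by (rule suminf_mult)
      finally show "norm (\<Sum>n. norm (\<beta> (a k n) (b k n)))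
          \<le> norm \<beta> * (\<Sum>n. norm (a k n) * norm (b k n))"
        by (simp add: suminf_nonneg summable_bilinear_form[OF s])
    qed
    then have "(\<lambda>k. \<Sum>n. \<beta> (a k n) (b k n)) sums (\<Sum>m. \<beta> (a' m) (b' m))"
      unfolding a'_def b'_def d_def by (intro double_series(2) summable_bilinear_form s)
    then show ?thesis using rep v by (simp add: represents_def)
  qed
  then show ?thesis using that v 1(2) by blast
qed

lemma represents_scaleC:
  assumes "represents a b u"
  shows "represents (\<lambda>n. c *\<^sub>C a n) b (c *\<^sub>C u)"
    "(\<Sum>n. norm (c *\<^sub>C a n) * norm (b n)) = cmod c * (\<Sum>n. norm (a n) * norm (b n))"
proof -
  have s: "summable (\<lambda>n. norm (a n) * norm (b n))"
    and u: "\<And>\<beta>. u \<beta> = (\<Sum>n. \<beta> (a n) (b n))"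
    using assms by (auto simp: represents_def)
  show "represents (\<lambda>n. c *\<^sub>C a n) b (c *\<^sub>C u)"
    using summable_mult[OF s, of "cmod c"]
      suminf_mult[OF summable_norm_cancel[OF summable_bilinear_form[OF s]], of c]
    by (simp add: represents_def norm_scaleC mult.assoc cblinfun_simps u scaleC_complex_def)
  show "(\<Sum>n. norm (c *\<^sub>C a n) * norm (b n)) = cmod c * (\<Sum>n. norm (a n) * norm (b n))"
    using suminf_mult[OF s, of "cmod c"] by (simp add: norm_scaleC mult.assoc)
qed

lemma represents_add:
  assumes "represents a b u" "represents a' b' u'"
  obtains a'' b'' where "represents a'' b'' (u + u')"
    "(\<Sum>n. norm (a'' n) * norm (b'' n)) =
      (\<Sum>n. norm (a n) * norm (b n)) + (\<Sum>n. norm (a' n) * norm (b' n))"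
proof -
  define A where "A k = (if k = 0 then a else if k = 1 then a' else (\<lambda>_. 0))" for k :: nat
  define B where "B k = (if k = 0 then b else if k = 1 then b' else (\<lambda>_. 0))" for k :: nat
  define U where "U k = (if k = 0 then u else if k = 1 then u' else 0)" for k :: nat
  have rep: "represents (A k) (B k) (U k)" for k
    using assms by (auto simp: A_def B_def U_def represents_zero)
  have "(\<lambda>k. \<Sum>n. norm (A k n) * norm (B k n)) sums
      (\<Sum>k\<in>{0, 1}. \<Sum>n. norm (A k n) * norm (B k n))"
    by (rule sums_finite) (auto simp: A_def)
  then have s: "(\<lambda>k. \<Sum>n. norm (A k n) * norm (B k n)) sums
      ((\<Sum>n. norm (a n) * norm (b n)) + (\<Sum>n. norm (a' n) * norm (b' n)))"
    by (simp add: A_def B_def)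
  obtain a'' b'' v where v: "represents a'' b'' v"
    "(\<Sum>n. norm (a'' n) * norm (b'' n)) = (\<Sum>k. \<Sum>n. norm (A k n) * norm (B k n))"
    "\<And>\<beta>. (\<lambda>k. U k \<beta>) sums v \<beta>"
    using represents_double[OF rep sums_summable[OF s]] by blast
  have "v = u + u'"
  proof (rule cblinfun_eqI, rule sums_unique2[OF v(3)])
    fix \<beta>
    have "(\<lambda>k. U k \<beta>) sums (\<Sum>k\<in>{0, 1}. U k \<beta>)" by (rule sums_finite) (auto simp: U_def)
    then show "(\<lambda>k. U k \<beta>) sums (u + u') \<beta>" by (simp add: U_def cblinfun_simps)
  qed
  then show ?thesis using that v(1,2) sums_unique[OF s] by metis
qed


instantiation ptensor :: (complex_normed_vector, complex_normed_vector) complex_normed_vector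
begin

lift_definition norm_ptensor :: "'a \<otimes>\<^sub>\<pi> 'b \<Rightarrow> real"
  is "\<lambda>u. Inf {\<Sum>n. norm (a n) * norm (b n) | a b. represents a b u}" .

lift_definition scaleC_ptensor :: "complex \<Rightarrow> 'a \<otimes>\<^sub>\<pi> 'b \<Rightarrow> 'a \<otimes>\<^sub>\<pi> 'b" is "\<lambda>c u. c *\<^sub>C u"
  using represents_scaleC(1) by blast

lift_definition scaleR_ptensor :: "real \<Rightarrow> 'a \<otimes>\<^sub>\<pi> 'b \<Rightarrow> 'a \<otimes>\<^sub>\<pi> 'b" is "\<lambda>r u. r *\<^sub>R u"
  unfolding scaleR_scaleC using represents_scaleC(1) by blast

lift_definition uminus_ptensor :: "'a \<otimes>\<^sub>\<pi> 'b \<Rightarrow> 'a \<otimes>\<^sub>\<pi> 'b" is "\<lambda>u. - u"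
  using represents_scaleC(1)[of _ _ _ "-1"] scaleR_scaleC[of "-1"]
  by (metis of_real_1 of_real_minus scaleR_minus1_left)

lift_definition zero_ptensor :: "'a \<otimes>\<^sub>\<pi> 'b" is 0
  using represents_zero by blast

lift_definition plus_ptensor :: "'a \<otimes>\<^sub>\<pi> 'b \<Rightarrow> 'a \<otimes>\<^sub>\<pi> 'b \<Rightarrow> 'a \<otimes>\<^sub>\<pi> 'b" is "\<lambda>u v. u + v"
  using represents_add by metis

definition minus_ptensor :: "'a \<otimes>\<^sub>\<pi> 'b \<Rightarrow> 'a \<otimes>\<^sub>\<pi> 'b \<Rightarrow> 'a \<otimes>\<^sub>\<pi> 'b"
  where "minus_ptensor u v = u + - v"

definition dist_ptensor :: "'a \<otimes>\<^sub>\<pi> 'b \<Rightarrow> 'a \<otimes>\<^sub>\<pi> 'b \<Rightarrow> real"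
  where "dist_ptensor u v = norm (u - v)"

definition [code del]:
  "(uniformity :: (('a \<otimes>\<^sub>\<pi> 'b) \<times> ('a \<otimes>\<^sub>\<pi> 'b)) filter) =
    (INF e\<in>{0 <..}. principal {(x, y). dist x y < e})"

definition open_ptensor :: "('a \<otimes>\<^sub>\<pi> 'b) set \<Rightarrow> bool"
  where [code del]: "open_ptensor S = (\<forall>x\<in>S. \<forall>\<^sub>F (x', y) in uniformity. x' = x \<longrightarrow> y \<in> S)"

definition sgn_ptensor :: "'a \<otimes>\<^sub>\<pi> 'b \<Rightarrow> 'a \<otimes>\<^sub>\<pi> 'b"
  where "sgn_ptensor u = inverse (norm u) *\<^sub>R u"

lemma ptensor_norm_aux:
  fixes u :: "'a \<otimes>\<^sub>\<pi> 'b"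
  shows "represents a b (Rep_ptensor u) \<Longrightarrow> norm u \<le> (\<Sum>n. norm (a n) * norm (b n))"
    "norm u < s \<Longrightarrow> \<exists>a b. represents a b (Rep_ptensor u) \<and> (\<Sum>n. norm (a n) * norm (b n)) < s"
    "0 \<le> norm u"
    "cmod (Rep_ptensor u \<beta>) \<le> norm \<beta> * norm u"
proof -
  let ?S = "{\<Sum>n. norm (a n) * norm (b n) | a b. represents a b (Rep_ptensor u)}"
  have ne: "?S \<noteq> {}" using Rep_ptensor[of u] by auto
  have pos: "0 \<le> s" if "s \<in> ?S" for s
    using that by (auto simp: represents_def intro!: suminf_nonneg)
  then have bdd: "bdd_below ?S" by (rule bdd_belowI)
  show "norm u \<le> (\<Sum>n. norm (a n) * norm (b n))" if "represents a b (Rep_ptensor u)"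
    unfolding norm_ptensor.rep_eq by (rule cInf_lower[OF _ bdd]) (use that in blast)
  show approx: "\<exists>a b. represents a b (Rep_ptensor u) \<and> (\<Sum>n. norm (a n) * norm (b n)) < s"
    if "norm u < s" for s
    using cInf_lessD[OF ne that[unfolded norm_ptensor.rep_eq]] by blast
  show nn: "0 \<le> norm u"
    unfolding norm_ptensor.rep_eq by (rule cInf_greatest[OF ne pos])
  show "cmod (Rep_ptensor u \<beta>) \<le> norm \<beta> * norm u"
  proof (rule field_le_epsilon)
    fix e :: real assume e: "0 < e"
    define d where "d = e / (norm \<beta> + 1)"
    have "0 < d" using e by (auto simp: d_def intro!: divide_pos_pos add_nonneg_pos)
    then obtain a b where ab: "represents a b (Rep_ptensor u)"
      "(\<Sum>n. norm (a n) * norm (b n)) < norm u + d"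
      using approx[of "norm u + d"] by auto
    have "cmod (Rep_ptensor u \<beta>) \<le> norm \<beta> * (\<Sum>n. norm (a n) * norm (b n))"
      using ab(1) suminf_bilinear_form_bound[of a b \<beta>] by (simp add: represents_def)
    also have "\<dots> \<le> norm \<beta> * (norm u + d)" using ab(2) by (intro mult_left_mono) auto
    also have "\<dots> \<le> norm \<beta> * norm u + (norm \<beta> + 1) * d" using \<open>0 < d\<close> by (simp add: algebra_simps)
    also have "(norm \<beta> + 1) * d = e" by (simp add: d_def add_nonneg_pos less_imp_neq[symmetric])
    finally show "cmod (Rep_ptensor u \<beta>) \<le> norm \<beta> * norm u + e" .
  qed
qed

instance
proof
  fix u v w :: "'a \<otimes>\<^sub>\<pi> 'b" and c d :: complex and r s :: real
  show "u + v + w = u + (v + w)" "u + v = v + u" "0 + u = u" "- u + u = 0"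
    "r *\<^sub>R (u + v) = r *\<^sub>R u + r *\<^sub>R v" "(r + s) *\<^sub>R u = r *\<^sub>R u + s *\<^sub>R u"
    "r *\<^sub>R s *\<^sub>R u = (r * s) *\<^sub>R u" "1 *\<^sub>R u = u"
    "c *\<^sub>C (u + v) = c *\<^sub>C u + c *\<^sub>C v" "(c + d) *\<^sub>C u = c *\<^sub>C u + d *\<^sub>C u"
    "c *\<^sub>C d *\<^sub>C u = (c * d) *\<^sub>C u" "r *\<^sub>R u = complex_of_real r *\<^sub>C u"
    by (transfer, simp add: algebra_simps scaleC_add_right scaleC_add_left scaleC_scaleC
        scaleR_scaleC)+
  show "u - v = u + - v" by (simp add: minus_ptensor_def)
  show "norm (u + v) \<le> norm u + norm v"
  proof (rule field_le_epsilon)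
    fix e :: real assume "0 < e"
    then obtain a b a' b' where u: "represents a b (Rep_ptensor u)"
      "(\<Sum>n. norm (a n) * norm (b n)) < norm u + e / 2"
      and v: "represents a' b' (Rep_ptensor v)"
      "(\<Sum>n. norm (a' n) * norm (b' n)) < norm v + e / 2"
      using ptensor_norm_aux(2)[of u "norm u + e / 2"] ptensor_norm_aux(2)[of v "norm v + e / 2"]
      by auto
    obtain a'' b'' where "represents a'' b'' (Rep_ptensor (u + v))"
      "(\<Sum>n. norm (a'' n) * norm (b'' n)) =
        (\<Sum>n. norm (a n) * norm (b n)) + (\<Sum>n. norm (a' n) * norm (b' n))"
      unfolding plus_ptensor.rep_eq by (rule represents_add[OF u(1) v(1)])
    then show "norm (u + v) \<le> norm u + norm v + e"
      using ptensor_norm_aux(1)[of a'' b'' "u + v"] u v by simp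
  qed
  have le: "norm (c *\<^sub>C u) \<le> cmod c * norm u" for c and u :: "'a \<otimes>\<^sub>\<pi> 'b"
  proof (rule field_le_epsilon)
    fix e :: real assume e: "0 < e"
    define d where "d = e / (cmod c + 1)"
    have "0 < d" using e by (auto simp: d_def intro!: divide_pos_pos add_nonneg_pos)
    then obtain a b where ab: "represents a b (Rep_ptensor u)"
      "(\<Sum>n. norm (a n) * norm (b n)) < norm u + d"
      using ptensor_norm_aux(2)[of u "norm u + d"] by auto
    have "norm (c *\<^sub>C u) \<le> cmod c * (\<Sum>n. norm (a n) * norm (b n))"
      using ptensor_norm_aux(1) represents_scaleC[OF ab(1), of c]
      by (metis scaleC_ptensor.rep_eq)
    also have "\<dots> \<le> cmod c * (norm u + d)" using ab(2) by (intro mult_left_mono) auto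
    also have "\<dots> \<le> cmod c * norm u + (cmod c + 1) * d" using \<open>0 < d\<close> by (simp add: algebra_simps)
    also have "(cmod c + 1) * d = e" by (simp add: d_def add_nonneg_pos less_imp_neq[symmetric])
    finally show "norm (c *\<^sub>C u) \<le> cmod c * norm u + e" .
  qed
  have scaleC: "norm (c *\<^sub>C u) = cmod c * norm u" for c and u :: "'a \<otimes>\<^sub>\<pi> 'b"
  proof (cases "c = 0")
    case True
    then show ?thesis using le[of c u] ptensor_norm_aux(3)[of "c *\<^sub>C u"] by simp
  next
    case False
    have "u = inverse c *\<^sub>C c *\<^sub>C u"
      using False by transfer (simp add: scaleC_scaleC)
    then have "norm u \<le> cmod (inverse c) * norm (c *\<^sub>C u)" using le by metis
    then have "cmod c * norm u \<le> norm (c *\<^sub>C u)"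
      using False by (simp add: norm_inverse norm_divide field_simps)
    then show ?thesis using le[of c u] by simp
  qed
  then show "norm (c *\<^sub>C u) = cmod c * norm u" .
  have "r *\<^sub>R u = of_real r *\<^sub>C u" by transfer (simp add: scaleR_scaleC)
  then show "norm (r *\<^sub>R u) = \<bar>r\<bar> * norm u" by (simp add: scaleC)
  show "norm u = 0 \<longleftrightarrow> u = 0"
  proof
    assume "norm u = 0"
    then have "Rep_ptensor u \<beta> = 0" for \<beta> using ptensor_norm_aux(4)[of u \<beta>] by simp
    then have "Rep_ptensor u = 0" by (intro cblinfun_eqI) simp
    then show "u = 0" by transfer
  next
    assume "u = 0"
    have "0 = (0 :: complex) *\<^sub>C (0 :: 'a \<otimes>\<^sub>\<pi> 'b)" by transfer simp
    then show "norm u = 0" using scaleC[of 0 u] \<open>u = 0\<close> by simp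
  qed
qed (simp_all only: dist_ptensor_def open_ptensor_def sgn_ptensor_def uniformity_ptensor_def)

end

lemma ptensor_represents:
  obtains a b where "represents a b (Rep_ptensor u)"
  using Rep_ptensor[of u] by blast

lemma norm_ptensor_le:
  "represents a b (Rep_ptensor u) \<Longrightarrow> norm u \<le> (\<Sum>n. norm (a n) * norm (b n))"
  by (rule ptensor_norm_aux)

lemma norm_ptensor_less:
  assumes "norm (u :: 'a::complex_normed_vector \<otimes>\<^sub>\<pi> 'b::complex_normed_vector) < s"
  obtains a b where "represents a b (Rep_ptensor u)" "(\<Sum>n. norm (a n) * norm (b n)) < s"
  using ptensor_norm_aux(2)[OF assms] by blast

lemma norm_Rep_ptensor: "cmod (cblinfun_apply (Rep_ptensor u) \<beta>) \<le> norm \<beta> * norm u"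
  by (rule ptensor_norm_aux)

lemma ptensor_series:
  fixes u :: "nat \<Rightarrow> 'a::complex_normed_vector \<otimes>\<^sub>\<pi> 'b::complex_normed_vector"
  assumes u: "\<And>k. norm (u k) < s k" and s: "summable s"
  obtains v where "norm v \<le> suminf s"
    "\<And>\<beta>. (\<lambda>k. cblinfun_apply (Rep_ptensor (u k)) \<beta>) sums cblinfun_apply (Rep_ptensor v) \<beta>"
proof -
  have "\<forall>k. \<exists>a b. represents a b (Rep_ptensor (u k)) \<and> (\<Sum>n. norm (a n) * norm (b n)) < s k"
    using u norm_ptensor_less by metis
  then obtain a b where rep: "\<And>k. represents (a k) (b k) (Rep_ptensor (u k))"
    and less: "\<And>k. (\<Sum>n. norm (a k n) * norm (b k n)) < s k"
    by metis
  have "0 \<le> (\<Sum>n. norm (a k n) * norm (b k n))" for k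
    using rep by (intro suminf_nonneg) (auto simp: represents_def)
  then have sum: "summable (\<lambda>k. \<Sum>n. norm (a k n) * norm (b k n))"
    using less by (intro summable_comparison_test'[OF s, of 0]) (simp add: less_imp_le)
  obtain a' b' v where v: "represents a' b' v"
    "(\<Sum>n. norm (a' n) * norm (b' n)) = (\<Sum>k. \<Sum>n. norm (a k n) * norm (b k n))"
    "\<And>\<beta>. (\<lambda>k. Rep_ptensor (u k) \<beta>) sums v \<beta>"
    using represents_double[OF rep sum] by blast
  have Rep: "Rep_ptensor (Abs_ptensor v) = v" using v(1) by (intro Abs_ptensor_inverse) auto
  show ?thesis
  proof
    have "norm (Abs_ptensor v) \<le> (\<Sum>k. \<Sum>n. norm (a k n) * norm (b k n))"
      using norm_ptensor_le[of a' b' "Abs_ptensor v"] v Rep by simp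
    also have "\<dots> \<le> suminf s" using less sum s by (intro suminf_le less_imp_le) auto
    finally show "norm (Abs_ptensor v) \<le> suminf s" .
    show "(\<lambda>k. Rep_ptensor (u k) \<beta>) sums Rep_ptensor (Abs_ptensor v) \<beta>" for \<beta>
      using v(3) Rep by simp
  qed
qed

lemma Rep_ptensor_diff: "Rep_ptensor (u - v) = Rep_ptensor u - Rep_ptensor v"
  by (metis add_diff_cancel diff_add_cancel plus_ptensor.rep_eq)

lemma ptensor_eqI:
  assumes "\<And>\<beta>. cblinfun_apply (Rep_ptensor u) \<beta> = cblinfun_apply (Rep_ptensor v) \<beta>"
  shows "u = v"
  using assms cblinfun_eqI Rep_ptensor_inject by metis

instance ptensor :: (complex_normed_vector, complex_normed_vector) complex_banach
proof
  fix X :: "nat \<Rightarrow> 'a \<otimes>\<^sub>\<pi> 'b"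
  assume X: "Cauchy X"
  have "\<exists>M. \<forall>m\<ge>M. \<forall>n\<ge>M. norm (X m - X n) < (1/2) ^ k" for k
    using CauchyD[OF X, of "(1/2) ^ k"] by auto
  then obtain M where M: "\<And>k m n. M k \<le> m \<Longrightarrow> M k \<le> n \<Longrightarrow> norm (X m - X n) < (1/2) ^ k"
    by metis
  define r where "r = rec_nat (M 0) (\<lambda>k x. max x (M (Suc k)))"
  have r_M: "M k \<le> r k" for k by (cases k) (auto simp: r_def)
  have r_Suc: "r k \<le> r (Suc k)" for k by (simp add: r_def)
  define D where "D k = X (r (Suc k)) - X (r k)" for k
  have D: "norm (D k) < (1/2) ^ k" for k
    unfolding D_def using r_M r_Suc order_trans by (intro M) blast+
  have sm: "summable (\<lambda>j. (1/2 :: real) ^ (j + k))" for k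
    by (simp add: power_add summable_mult2)
  have "(\<Sum>j. (1/2 :: real) ^ (j + k)) = 2 * (1/2) ^ k" for k
    using suminf_mult2[OF summable_geometric[of "1/2 :: real"], of "(1/2) ^ k"]
    by (simp add: power_add suminf_geometric)
  then have "\<exists>v. norm v \<le> 2 * (1/2) ^ k \<and>
      (\<forall>\<beta>. (\<lambda>j. Rep_ptensor (D (j + k)) \<beta>) sums Rep_ptensor v \<beta>)" for k
    using ptensor_series[OF D sm, of k] by metis
  then obtain V where V: "\<And>k. norm (V k) \<le> 2 * (1/2) ^ k"
    and V_sums: "\<And>k \<beta>. (\<lambda>j. Rep_ptensor (D (j + k)) \<beta>) sums Rep_ptensor (V k) \<beta>"
    by metis
  have V_eq: "V 0 + X (r 0) - X (r k) = V k" for k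
  proof (rule ptensor_eqI)
    fix \<beta>
    have "(\<Sum>j<k. Rep_ptensor (D j) \<beta>) = Rep_ptensor (X (r k)) \<beta> - Rep_ptensor (X (r 0)) \<beta>"
      by (induction k) (simp_all add: D_def Rep_ptensor_diff cblinfun_simps)
    moreover have "(\<lambda>j. Rep_ptensor (D (j + k)) \<beta>) sums
        (Rep_ptensor (V 0) \<beta> - (\<Sum>j<k. Rep_ptensor (D j) \<beta>))"
      using V_sums[where k = 0 and \<beta> = \<beta>] by (subst sums_iff_shift) simp
    ultimately show "Rep_ptensor (V 0 + X (r 0) - X (r k)) \<beta> = Rep_ptensor (V k) \<beta>"
      using sums_unique2[OF _ V_sums[where k = k and \<beta> = \<beta>]]
      by (simp add: Rep_ptensor_diff plus_ptensor.rep_eq cblinfun_simps)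
  qed
  have "X \<longlonglongrightarrow> V 0 + X (r 0)"
  proof (rule LIMSEQ_I)
    fix e :: real assume "0 < e"
    then obtain k where k: "(1/2) ^ k < e / 3"
      using real_arch_pow_inv[of "e / 3" "1/2"] by auto
    have "norm (X n - (V 0 + X (r 0))) < e" if n: "r k \<le> n" for n
    proof -
      have "norm (X n - (V 0 + X (r 0))) = norm ((X n - X (r k)) - V k)"
        by (simp add: V_eq[of k, symmetric])
      also have "\<dots> \<le> norm (X n - X (r k)) + norm (V k)" by (rule norm_triangle_ineq4)
      also have "\<dots> < (1/2) ^ k + 2 * (1/2) ^ k"
        using M[of k n "r k"] r_M[of k] n V[of k] by simp
      finally show ?thesis using k by simp
    qed
    then show "\<exists>no. \<forall>n\<ge>no. norm (X n - (V 0 + X (r 0))) < e" by blast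
  qed
  then show "convergent X" by (rule convergentI)
qed


lemma bounded_clinear_Rep_ptensor: "bounded_clinear (\<lambda>u. cblinfun_apply (Rep_ptensor u) \<beta>)"
  by (rule bounded_clinear_intro[of _ "norm \<beta>"])
    (simp_all add: plus_ptensor.rep_eq scaleC_ptensor.rep_eq cblinfun_simps norm_Rep_ptensor)

lemma bounded_clinear_evaluation:
  "bounded_clinear (\<lambda>\<beta>. cblinfun_apply (cblinfun_apply \<beta> a) b)"
proof (rule bounded_clinear_intro[of _ "norm a * norm b"])
  show "norm (cblinfun_apply (cblinfun_apply \<beta> a) b) \<le> norm a * norm b * norm \<beta>" for \<beta>
    using bilinear_form_bound[of \<beta> a b] by (simp only: mult.commute[of "norm \<beta>"])
qed (simp_all add: cblinfun_simps)

lemma represents_single: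
  "represents (\<lambda>n. if n = 0 then a else 0) (\<lambda>n. if n = 0 then b else 0)
    (CBlinfun (\<lambda>\<beta>. cblinfun_apply (cblinfun_apply \<beta> a) b))"
proof -
  have "(\<lambda>n. \<beta> (if n = 0 then a else 0) (if n = 0 then b else 0)) sums
      (\<Sum>n\<in>{0 :: nat}. \<beta> (if n = 0 then a else 0) (if n = 0 then b else 0))"
    for \<beta> :: "'a \<Rightarrow>\<^sub>C\<^sub>L 'b \<Rightarrow>\<^sub>C\<^sub>L complex"
    by (rule sums_finite) auto
  moreover have "summable (\<lambda>n :: nat. norm (if n = 0 then a else 0) * norm (if n = 0 then b else 0))"
    by (rule summable_finite[of "{0}"]) auto
  ultimately show ?thesis
    by (simp add: represents_def CBlinfun_apply bounded_clinear_evaluation sums_iff)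
qed

lift_definition tensor ::
    "'a::complex_normed_vector \<Rightarrow> 'b::complex_normed_vector \<Rightarrow> 'a \<otimes>\<^sub>\<pi> 'b"  (infixr \<open>\<otimes>\<^sub>t\<close> 70)
  is "\<lambda>a b. CBlinfun (\<lambda>\<beta>. cblinfun_apply (cblinfun_apply \<beta> a) b)"
  using represents_single by blast

lemma Rep_tensor: "cblinfun_apply (Rep_ptensor (a \<otimes>\<^sub>t b)) \<beta> = cblinfun_apply (cblinfun_apply \<beta> a) b"
  by (simp add: tensor.rep_eq CBlinfun_apply bounded_clinear_evaluation)

lemma tensor_add_left: "(a + a') \<otimes>\<^sub>t b = a \<otimes>\<^sub>t b + a' \<otimes>\<^sub>t b"
  and tensor_add_right: "a \<otimes>\<^sub>t (b + b') = a \<otimes>\<^sub>t b + a \<otimes>\<^sub>t b'"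
  and tensor_scaleC_left: "(c *\<^sub>C a) \<otimes>\<^sub>t b = c *\<^sub>C (a \<otimes>\<^sub>t b)"
  and tensor_scaleC_right: "a \<otimes>\<^sub>t (c *\<^sub>C b) = c *\<^sub>C (a \<otimes>\<^sub>t b)"
  by (rule ptensor_eqI; simp add: Rep_tensor plus_ptensor.rep_eq scaleC_ptensor.rep_eq cblinfun_simps)+

lemma norm_tensor: "norm (a \<otimes>\<^sub>t b) = norm a * norm b"
proof (rule antisym)
  have "(\<lambda>n. norm (if n = 0 then a else 0) * norm (if n = 0 then b else 0)) sums
      (\<Sum>n\<in>{0 :: nat}. norm (if n = 0 then a else 0) * norm (if n = 0 then b else 0))"
    by (rule sums_finite) auto
  then show "norm (a \<otimes>\<^sub>t b) \<le> norm a * norm b"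
    using norm_ptensor_le[of _ _ "a \<otimes>\<^sub>t b", unfolded tensor.rep_eq, OF represents_single]
    by (simp add: sums_iff)
next
  obtain \<phi> :: "'a \<Rightarrow>\<^sub>C\<^sub>L complex" where \<phi>: "norm \<phi> \<le> 1" "\<phi> a = of_real (norm a)"
    by (rule complex_Hahn_Banach)
  obtain \<psi> :: "'b \<Rightarrow>\<^sub>C\<^sub>L complex" where \<psi>: "norm \<psi> \<le> 1" "\<psi> b = of_real (norm b)"
    by (rule complex_Hahn_Banach)
  have le: "norm (\<phi> x * \<psi> y) \<le> norm x * norm y" for x y
  proof -
    have "norm (\<phi> x) \<le> norm x" "norm (\<psi> y) \<le> norm y"
      using norm_cblinfun[of \<phi> x] norm_cblinfun[of \<psi> y] \<phi>(1) \<psi>(1)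
        mult_left_le_one_le[OF norm_ge_zero norm_ge_zero, of \<phi> x]
        mult_left_le_one_le[OF norm_ge_zero norm_ge_zero, of \<psi> y]
      by linarith+
    then show ?thesis by (simp add: norm_mult mult_mono)
  qed
  define \<beta> where "\<beta> = cbilinear (\<lambda>x y. \<phi> x * \<psi> y)"
  have "bounded_cbilinear (\<lambda>x y. \<phi> x * \<psi> y)"
    by (rule bounded_cbilinear_intro[of _ 1])
      (use le in \<open>auto simp: cblinfun_simps algebra_simps scaleC_complex_def\<close>)
  then have \<beta>: "\<beta> x y = \<phi> x * \<psi> y" for x y
    by (simp add: \<beta>_def cbilinear_apply)
  have "norm \<beta> \<le> 1"
  proof (rule norm_cblinfun_bound)
    show "norm (\<beta> x) \<le> 1 * norm x" for x
      by (rule norm_cblinfun_bound) (use le in \<open>auto simp: \<beta>\<close>)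
  qed simp
  have "norm a * norm b = cmod (Rep_ptensor (a \<otimes>\<^sub>t b) \<beta>)"
    by (simp add: Rep_tensor \<beta> \<phi> \<psi> norm_mult)
  also have "\<dots> \<le> norm \<beta> * norm (a \<otimes>\<^sub>t b)" by (rule norm_Rep_ptensor)
  also have "\<dots> \<le> 1 * norm (a \<otimes>\<^sub>t b)" using \<open>norm \<beta> \<le> 1\<close> by (rule mult_right_mono) simp
  finally show "norm a * norm b \<le> norm (a \<otimes>\<^sub>t b)" by simp
qed

lemma bounded_cbilinear_tensor: "bounded_cbilinear tensor"
  by (rule bounded_cbilinear_intro[of _ 1])
    (simp_all add: tensor_add_left tensor_add_right tensor_scaleC_left tensor_scaleC_right norm_tensor)

lemma represents_sums:
  assumes "represents a b (Rep_ptensor u)"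
  shows "(\<lambda>n. a n \<otimes>\<^sub>t b n) sums u"
proof -
  have "summable (\<lambda>n. norm (a n \<otimes>\<^sub>t b n))"
    using assms by (simp add: represents_def norm_tensor)
  then obtain v where v: "(\<lambda>n. a n \<otimes>\<^sub>t b n) sums v"
    using summable_sums[OF summable_norm_cancel] by metis
  have "v = u"
  proof (rule ptensor_eqI)
    fix \<beta>
    have "(\<lambda>n. Rep_ptensor (a n \<otimes>\<^sub>t b n) \<beta>) sums Rep_ptensor v \<beta>"
      using bounded_clinear_Rep_ptensor[of \<beta>] unfolding bounded_clinear_def
      by (intro bounded_linear.sums[OF _ v]) simp
    then show "Rep_ptensor v \<beta> = Rep_ptensor u \<beta>"
      using assms by (simp add: Rep_tensor represents_def sums_iff)
  qed
  then show ?thesis using v by simp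
qed

lemma ptensor_sums:
  assumes "norm (u :: 'a::complex_normed_vector \<otimes>\<^sub>\<pi> 'b::complex_normed_vector) < s"
  obtains a b where "summable (\<lambda>n. norm (a n) * norm (b n))"
    "(\<Sum>n. norm (a n) * norm (b n)) < s" "(\<lambda>n. a n \<otimes>\<^sub>t b n) sums u"
proof -
  obtain a b where ab: "represents a b (Rep_ptensor u)" "(\<Sum>n. norm (a n) * norm (b n)) < s"
    by (rule norm_ptensor_less[OF assms])
  show ?thesis
  proof (rule that)
    show "summable (\<lambda>n. norm (a n) * norm (b n))" using ab(1) by (simp add: represents_def)
  qed (rule ab(2), rule represents_sums[OF ab(1)])
qed

lemma ptensor_ext:
  assumes f: "bounded_clinear f" and g: "bounded_clinear g"
    and eq: "\<And>a b. f (a \<otimes>\<^sub>t b) = g (a \<otimes>\<^sub>t b)"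
  shows "f u = g u"
proof -
  obtain a b where u: "(\<lambda>n. a n \<otimes>\<^sub>t b n) sums u"
    by (rule ptensor_sums[of u "norm u + 1"]) simp_all
  have "(\<lambda>n. f (a n \<otimes>\<^sub>t b n)) sums f u" "(\<lambda>n. g (a n \<otimes>\<^sub>t b n)) sums g u"
    using f g unfolding bounded_clinear_def by (simp_all add: bounded_linear.sums[OF _ u])
  then show ?thesis unfolding eq by (rule sums_unique2)
qed

lemma ptensor_cblinfun_eqI:
  assumes "\<And>a b. cblinfun_apply f (a \<otimes>\<^sub>t b) = cblinfun_apply g (a \<otimes>\<^sub>t b)"
  shows "f = g"
  using ptensor_ext[OF bounded_clinear_apply bounded_clinear_apply assms] by (rule cblinfun_eqI)

text \<open>
  The universal property: \<open>ptensor_lift f\<close> is the bounded linear map with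
  \<open>a \<otimes> b \<mapsto> f a b\<close>; it is only meaningful for bounded bilinear \<open>f\<close>.
\<close>

definition ptensor_lift ::
    "('a::complex_normed_vector \<Rightarrow> 'b::complex_normed_vector \<Rightarrow> 'c::complex_banach) \<Rightarrow>
      ('a \<otimes>\<^sub>\<pi> 'b \<Rightarrow>\<^sub>C\<^sub>L 'c)"
  where "ptensor_lift f = (THE L. \<forall>a b. cblinfun_apply L (a \<otimes>\<^sub>t b) = f a b)"

theorem ptensor_universal:
  fixes f :: "'a::complex_normed_vector \<Rightarrow> 'b::complex_normed_vector \<Rightarrow> 'c::complex_banach"
  assumes f: "bounded_cbilinear f"
  shows "\<exists>!L. \<forall>a b. cblinfun_apply L (a \<otimes>\<^sub>t b) = f a b"
proof (rule ex_ex1I)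
  define \<Phi> where "\<Phi> \<phi> = cbilinear (\<lambda>a b. cblinfun_apply \<phi> (f a b))" for \<phi> :: "'c \<Rightarrow>\<^sub>C\<^sub>L complex"
  define T where "T = cbilinear f"
  have T: "T a b = f a b" for a b by (simp add: T_def cbilinear_apply f)
  have \<Phi>: "\<Phi> \<phi> a b = \<phi> (f a b)" for \<phi> a b
  proof -
    have "norm (\<phi> (f a b)) \<le> (norm \<phi> * norm T) * norm a * norm b" for a b
    proof -
      have "norm (\<phi> (f a b)) \<le> norm \<phi> * norm (T a b)" unfolding T by (rule norm_cblinfun)
      also have "\<dots> \<le> norm \<phi> * (norm T * (norm a * norm b))"
        by (intro mult_left_mono bilinear_form_bound) simp
      finally show ?thesis by (simp add: mult.assoc)
    qed
    then have "bounded_cbilinear (\<lambda>a b. \<phi> (f a b))"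
      using f unfolding bounded_cbilinear_def by (auto simp: cblinfun_simps)
    then show ?thesis by (simp add: \<Phi>_def cbilinear_apply)
  qed
  have rep: "\<phi> (\<Sum>n. T (a n) (b n)) = Rep_ptensor u (\<Phi> \<phi>)"
    if ab: "represents a b (Rep_ptensor u)" for a b u and \<phi> :: "'c \<Rightarrow>\<^sub>C\<^sub>L complex"
  proof -
    have "summable (\<lambda>n. T (a n) (b n))"
      using ab summable_norm_cancel[OF summable_bilinear_form] by (auto simp: represents_def)
    then have "(\<lambda>n. \<phi> (T (a n) (b n))) sums \<phi> (\<Sum>n. T (a n) (b n))"
      by (rule bounded_linear.sums[OF bounded_linear_cblinfun_apply summable_sums])
    then show ?thesis using ab by (simp add: represents_def \<Phi> T sums_iff)
  qed
  have "\<forall>u. \<exists>z. \<forall>\<phi>. cblinfun_apply \<phi> z = Rep_ptensor u (\<Phi> \<phi>)"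
    using rep ptensor_represents by metis
  then obtain L where L: "\<And>u \<phi>. cblinfun_apply \<phi> (L u) = Rep_ptensor u (\<Phi> \<phi>)" by metis
  have "bounded_clinear L"
  proof (rule bounded_clinear_intro)
    show "L (u + v) = L u + L v" for u v
      by (rule functionals_separate) (simp add: cblinfun_simps L plus_ptensor.rep_eq)
    show "L (c *\<^sub>C u) = c *\<^sub>C L u" for c u
      by (rule functionals_separate) (simp add: cblinfun_simps L scaleC_ptensor.rep_eq)
    show "norm (L u) \<le> norm T * norm u" for u
    proof (rule field_le_epsilon)
      fix e :: real assume e: "0 < e"
      define d where "d = e / (norm T + 1)"
      have "0 < d" using e by (auto simp: d_def intro!: divide_pos_pos add_nonneg_pos)
      then obtain a b where ab: "represents a b (Rep_ptensor u)"
        "(\<Sum>n. norm (a n) * norm (b n)) < norm u + d"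
        using norm_ptensor_less[of u "norm u + d"] by auto
      have "L u = (\<Sum>n. T (a n) (b n))"
        by (rule functionals_separate) (simp add: L rep[OF ab(1)])
      then have "norm (L u) \<le> norm T * (\<Sum>n. norm (a n) * norm (b n))"
        using ab(1) suminf_bilinear_form_bound[of a b T] by (simp add: represents_def)
      also have "\<dots> \<le> norm T * (norm u + d)" using ab(2) by (intro mult_left_mono) auto
      also have "\<dots> \<le> norm T * norm u + (norm T + 1) * d"
        using \<open>0 < d\<close> by (simp add: algebra_simps)
      also have "(norm T + 1) * d = e" by (simp add: d_def add_nonneg_pos less_imp_neq[symmetric])
      finally show "norm (L u) \<le> norm T * norm u + e" .
    qed
  qed
  moreover have "L (a \<otimes>\<^sub>t b) = f a b" for a b
    by (rule functionals_separate) (simp add: L Rep_tensor \<Phi>)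
  ultimately show "\<exists>L. \<forall>a b. cblinfun_apply L (a \<otimes>\<^sub>t b) = f a b"
    by (intro exI[of _ "CBlinfun L"]) (simp add: CBlinfun_apply)
qed (auto intro: ptensor_cblinfun_eqI)

lemma ptensor_lift_tensor:
  "bounded_cbilinear f \<Longrightarrow> cblinfun_apply (ptensor_lift f) (a \<otimes>\<^sub>t b) = f a b"
  using theI'[OF ptensor_universal[of f]] unfolding ptensor_lift_def by blast

lemma norm_ptensor_bound:
  fixes L :: "'a::complex_normed_vector \<otimes>\<^sub>\<pi> 'b::complex_normed_vector \<Rightarrow>\<^sub>C\<^sub>L 'c::complex_banach"
  assumes "0 \<le> K" and "\<And>a b. norm (L (a \<otimes>\<^sub>t b)) \<le> K * norm a * norm b"
  shows "norm L \<le> K"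
proof (rule norm_cblinfun_bound)
  fix u
  show "norm (L u) \<le> K * norm u"
  proof (rule field_le_epsilon)
    fix e :: real assume e: "0 < e"
    define d where "d = e / (K + 1)"
    have "0 < d" using e \<open>0 \<le> K\<close> by (simp add: d_def)
    then obtain a b where ab: "summable (\<lambda>n. norm (a n) * norm (b n))"
      "(\<Sum>n. norm (a n) * norm (b n)) < norm u + d" "(\<lambda>n. a n \<otimes>\<^sub>t b n) sums u"
      using ptensor_sums[of u "norm u + d"] by auto
    have le: "norm (L (a n \<otimes>\<^sub>t b n)) \<le> K * (norm (a n) * norm (b n))" for n
      using assms(2) by (simp add: mult.assoc)
    have s: "summable (\<lambda>n. norm (L (a n \<otimes>\<^sub>t b n)))"
      by (rule summable_comparison_test'[OF summable_mult[OF ab(1), of K], of 0]) (simp add: le)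
    have "(\<lambda>n. L (a n \<otimes>\<^sub>t b n)) sums L u"
      by (rule bounded_linear.sums[OF bounded_linear_cblinfun_apply ab(3)])
    then have "norm (L u) \<le> (\<Sum>n. norm (L (a n \<otimes>\<^sub>t b n)))"
      using summable_norm[OF s] by (simp add: sums_iff)
    also have "\<dots> \<le> (\<Sum>n. K * (norm (a n) * norm (b n)))"
      by (intro suminf_le le s summable_mult ab)
    also have "\<dots> = K * (\<Sum>n. norm (a n) * norm (b n))" using ab(1) by (rule suminf_mult)
    also have "\<dots> \<le> K * (norm u + d)" using ab(2) assms(1) by (intro mult_left_mono) auto
    also have "\<dots> \<le> K * norm u + (K + 1) * d" using \<open>0 < d\<close> by (simp add: algebra_simps)
    also have "(K + 1) * d = e" using assms(1) by (simp add: d_def)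
    finally show "norm (L u) \<le> K * norm u + e" .
  qed
qed fact

text \<open>\<open>S \<otimes> T\<close> for bounded linear maps \<open>S\<close> and \<open>T\<close>.\<close>

definition ptensor_map ::
    "('a::complex_normed_vector \<Rightarrow>\<^sub>C\<^sub>L 'c::complex_normed_vector) \<Rightarrow>
      ('b::complex_normed_vector \<Rightarrow>\<^sub>C\<^sub>L 'd::complex_normed_vector) \<Rightarrow>
      ('a \<otimes>\<^sub>\<pi> 'b \<Rightarrow>\<^sub>C\<^sub>L 'c \<otimes>\<^sub>\<pi> 'd)"
  where "ptensor_map S T = ptensor_lift (\<lambda>a b. S a \<otimes>\<^sub>t T b)"

lemma ptensor_map_tensor: "cblinfun_apply (ptensor_map S T) (a \<otimes>\<^sub>t b) = S a \<otimes>\<^sub>t T b"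
proof -
  have "norm (S a \<otimes>\<^sub>t T b) \<le> norm S * norm T * norm a * norm b" for a b
    using mult_mono[OF norm_cblinfun[of S a] norm_cblinfun[of T b]]
    by (simp add: norm_tensor mult.assoc mult.left_commute)
  then have "bounded_cbilinear (\<lambda>a b. S a \<otimes>\<^sub>t T b)"
    by (intro bounded_cbilinear_intro) (simp_all add: cblinfun_simps
        tensor_add_left tensor_add_right tensor_scaleC_left tensor_scaleC_right)
  then show ?thesis by (simp add: ptensor_map_def ptensor_lift_tensor)
qed


section \<open>The projective tensor product of Banach algebras\<close>

lift_definition lmult :: "'a::complex_normed_algebra \<Rightarrow> 'a \<Rightarrow>\<^sub>C\<^sub>L 'a" is "\<lambda>a x. a * x"
  by (simp add: bounded_clinear_def bounded_linear_mult_right mult_scaleC_right)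

lift_definition rmult :: "'a::complex_normed_algebra \<Rightarrow> 'a \<Rightarrow>\<^sub>C\<^sub>L 'a" is "\<lambda>a x. x * a"
  by (simp add: bounded_clinear_def bounded_linear_mult_left mult_scaleC_left)

declare lmult.rep_eq [simp] rmult.rep_eq [simp]

lemma norm_lmult: "norm (lmult a) \<le> norm a"
  by (rule norm_cblinfun_bound) (simp_all add: norm_mult_ineq)

lemma norm_ptensor_map_lmult: "norm (ptensor_map (lmult a) (lmult b)) \<le> 1 * norm a * norm b"
proof (rule norm_ptensor_bound)
  fix a' b'
  have "norm (ptensor_map (lmult a) (lmult b) (a' \<otimes>\<^sub>t b')) = norm (a * a') * norm (b * b')"
    by (simp add: ptensor_map_tensor norm_tensor)
  also have "\<dots> \<le> (norm a * norm a') * (norm b * norm b')"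
    by (intro mult_mono norm_mult_ineq) simp_all
  also have "\<dots> = 1 * norm a * norm b * norm a' * norm b'" by algebra
  finally show "norm (ptensor_map (lmult a) (lmult b) (a' \<otimes>\<^sub>t b'))
      \<le> 1 * norm a * norm b * norm a' * norm b'" .
qed simp

lemma bounded_cbilinear_ptensor_lmult:
  "bounded_cbilinear (\<lambda>(a :: 'a::complex_normed_algebra) (b :: 'b::complex_normed_algebra).
    ptensor_map (lmult a) (lmult b))"
proof (rule bounded_cbilinear_intro[of _ 1])
  show "norm (ptensor_map (lmult a) (lmult b)) \<le> 1 * norm a * norm b" for a :: 'a and b :: 'b
    by (rule norm_ptensor_map_lmult)
qed (rule ptensor_cblinfun_eqI; simp add: ptensor_map_tensor cblinfun_simps distrib_right
    tensor_add_left tensor_add_right tensor_scaleC_left tensor_scaleC_right mult_scaleC_left)+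

instantiation ptensor :: (complex_normed_algebra, complex_normed_algebra) complex_banach_algebra
begin

definition times_ptensor :: "'a \<otimes>\<^sub>\<pi> 'b \<Rightarrow> 'a \<otimes>\<^sub>\<pi> 'b \<Rightarrow> 'a \<otimes>\<^sub>\<pi> 'b"
  where "u * v = ptensor_lift (\<lambda>a b. ptensor_map (lmult a) (lmult b)) u v"

lemma tensor_mult_aux: "(a \<otimes>\<^sub>t b) * (a' \<otimes>\<^sub>t b') = (a * a') \<otimes>\<^sub>t (b * b')"
  for a a' :: 'a and b b' :: 'b
  by (simp add: times_ptensor_def ptensor_lift_tensor bounded_cbilinear_ptensor_lmult
      ptensor_map_tensor)

lemma norm_times_ptensor_aux: "norm (u * v) \<le> norm u * norm v" for u v :: "'a \<otimes>\<^sub>\<pi> 'b"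
proof -
  let ?M = "ptensor_lift (\<lambda>(a :: 'a) (b :: 'b). ptensor_map (lmult a) (lmult b))"
  have "norm ?M \<le> 1"
  proof (rule norm_ptensor_bound)
    show "norm (?M (a \<otimes>\<^sub>t b)) \<le> 1 * norm a * norm b" for a :: 'a and b :: 'b
      unfolding ptensor_lift_tensor[OF bounded_cbilinear_ptensor_lmult]
      by (rule norm_ptensor_map_lmult)
  qed simp
  have "norm (u * v) \<le> norm ?M * (norm u * norm v)"
    unfolding times_ptensor_def by (rule bilinear_form_bound)
  also have "\<dots> \<le> 1 * (norm u * norm v)" using \<open>norm ?M \<le> 1\<close> by (rule mult_right_mono) simp
  finally show ?thesis by simp
qed

instance
proof
  fix u v w :: "'a \<otimes>\<^sub>\<pi> 'b" and c :: complex and r :: real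
  show 1: "(u + v) * w = u * w + v * w" "w * (u + v) = w * u + w * v"
    "(c *\<^sub>C u) * v = c *\<^sub>C (u * v)" "u * (c *\<^sub>C v) = c *\<^sub>C (u * v)"
    for u v w :: "'a \<otimes>\<^sub>\<pi> 'b" and c
    by (simp_all add: times_ptensor_def cblinfun_simps)
  show "(r *\<^sub>R u) * v = r *\<^sub>R (u * v)" "u * (r *\<^sub>R v) = r *\<^sub>R (u * v)"
    by (simp_all add: scaleR_scaleC 1)
  show "norm (u * v) \<le> norm u * norm v" by (rule norm_times_ptensor_aux)
  have L: "bounded_clinear (\<lambda>x. x * z)" for z :: "'a \<otimes>\<^sub>\<pi> 'b"
  proof (rule bounded_clinear_intro[of _ "norm z"])
    show "norm (x * z) \<le> norm z * norm x" for x
      using norm_times_ptensor_aux[of x z] by (simp only: mult.commute[of "norm z"])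
  qed (simp_all only: 1)
  have R: "bounded_clinear (\<lambda>x. z * x)" for z :: "'a \<otimes>\<^sub>\<pi> 'b"
    by (rule bounded_clinear_intro[of _ "norm z"]) (simp_all only: 1 norm_times_ptensor_aux)
  have comp: "bounded_clinear (\<lambda>x. f (g x))" if "bounded_clinear f" "bounded_clinear g"
    for f g :: "'a \<otimes>\<^sub>\<pi> 'b \<Rightarrow> 'a \<otimes>\<^sub>\<pi> 'b"
    using that by (auto simp: bounded_clinear_def intro: bounded_linear_compose)
  show "u * v * w = u * (v * w)"
  proof (rule ptensor_ext[of "\<lambda>u. u * v * w" "\<lambda>u. u * (v * w)"])
    fix a b
    show "(a \<otimes>\<^sub>t b) * v * w = (a \<otimes>\<^sub>t b) * (v * w)"
    proof (rule ptensor_ext[of "\<lambda>v. (a \<otimes>\<^sub>t b) * v * w" "\<lambda>v. (a \<otimes>\<^sub>t b) * (v * w)"])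
      fix a' b'
      show "(a \<otimes>\<^sub>t b) * (a' \<otimes>\<^sub>t b') * w = (a \<otimes>\<^sub>t b) * ((a' \<otimes>\<^sub>t b') * w)"
      proof (rule ptensor_ext[of "\<lambda>w. (a \<otimes>\<^sub>t b) * (a' \<otimes>\<^sub>t b') * w"
            "\<lambda>w. (a \<otimes>\<^sub>t b) * ((a' \<otimes>\<^sub>t b') * w)"])
        show "(a \<otimes>\<^sub>t b) * (a' \<otimes>\<^sub>t b') * (a'' \<otimes>\<^sub>t b'') =
            (a \<otimes>\<^sub>t b) * ((a' \<otimes>\<^sub>t b') * (a'' \<otimes>\<^sub>t b''))" for a'' b''
          by (simp only: tensor_mult_aux mult.assoc)
      qed (rule R, rule comp[OF R R])
    qed (rule comp[OF L R], rule comp[OF R L])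
  qed (rule comp[OF L L], rule L)
qed

end

lemma tensor_mult: "(a \<otimes>\<^sub>t b) * (a' \<otimes>\<^sub>t b') = (a * a') \<otimes>\<^sub>t (b * b')"
  by (rule tensor_mult_aux)

text \<open>\<open>Hom\<close>: continuity and linearity are part of the type \<open>'a \<Rightarrow>\<^sub>C\<^sub>L 'a\<close>.\<close>

definition Hom :: "('a::complex_banach_algebra \<Rightarrow>\<^sub>C\<^sub>L 'a) set"
  where "Hom = {\<sigma> :: 'a \<Rightarrow>\<^sub>C\<^sub>L 'a. \<forall>x y. \<sigma> (x * y) = \<sigma> x * \<sigma> y}"

lemma ptensor_map_Hom:
  fixes \<sigma> :: "'a::complex_banach_algebra \<Rightarrow>\<^sub>C\<^sub>L 'a" and \<tau> :: "'b::complex_banach_algebra \<Rightarrow>\<^sub>C\<^sub>L 'b"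
  assumes \<sigma>: "\<sigma> \<in> Hom" and \<tau>: "\<tau> \<in> Hom"
  shows "ptensor_map \<sigma> \<tau> \<in> Hom"
proof -
  let ?T = "ptensor_map \<sigma> \<tau>"
  have "?T (u * v) = ?T u * ?T v" for u v
  proof -
    have M: "?T o\<^sub>C lmult x = lmult (?T x) o\<^sub>C ?T" if "x = a \<otimes>\<^sub>t b" for x a b
      unfolding that by (rule ptensor_cblinfun_eqI)
        (use \<sigma> \<tau> in \<open>simp add: ptensor_map_tensor tensor_mult Hom_def\<close>)
    have "?T o\<^sub>C rmult v = rmult (?T v) o\<^sub>C ?T"
    proof (rule ptensor_cblinfun_eqI)
      fix a b
      show "(?T o\<^sub>C rmult v) (a \<otimes>\<^sub>t b) = (rmult (?T v) o\<^sub>C ?T) (a \<otimes>\<^sub>t b)"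
        using arg_cong[OF M[OF refl, of a b], of "\<lambda>S. cblinfun_apply S v"] by simp
    qed
    then show ?thesis by (metis cblinfun_compose.rep_eq rmult.rep_eq)
  qed
  then show ?thesis by (simp add: Hom_def)
qed


section \<open>Biflatness relative to a homomorphism\<close>

text \<open>
  The bimodule \<open>A \<otimes> A\<close>: \<open>ptensor_lact a\<close> is \<open>x \<mapsto> a \<cdot> x\<close>, \<open>ptensor_ract a\<close> is \<open>x \<mapsto> x \<cdot> a\<close>.
\<close>

definition ptensor_lact :: "'a::complex_normed_algebra \<Rightarrow> ('a \<otimes>\<^sub>\<pi> 'a \<Rightarrow>\<^sub>C\<^sub>L 'a \<otimes>\<^sub>\<pi> 'a)"
  where "ptensor_lact a = ptensor_map (lmult a) cblinfun_id"

definition ptensor_ract :: "'a::complex_normed_algebra \<Rightarrow> ('a \<otimes>\<^sub>\<pi> 'a \<Rightarrow>\<^sub>C\<^sub>L 'a \<otimes>\<^sub>\<pi> 'a)"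
  where "ptensor_ract a = ptensor_map cblinfun_id (rmult a)"

lemma ptensor_lact_tensor: "cblinfun_apply (ptensor_lact a) (b \<otimes>\<^sub>t c) = (a * b) \<otimes>\<^sub>t c"
  by (simp add: ptensor_lact_def ptensor_map_tensor)

lemma ptensor_ract_tensor: "cblinfun_apply (ptensor_ract a) (b \<otimes>\<^sub>t c) = b \<otimes>\<^sub>t (c * a)"
  by (simp add: ptensor_ract_def ptensor_map_tensor)

definition diagonal_op :: "'a::complex_banach_algebra \<otimes>\<^sub>\<pi> 'a \<Rightarrow>\<^sub>C\<^sub>L 'a"
  where "diagonal_op = ptensor_lift (\<lambda>a b. a * b)"

lemma diagonal_op_tensor: "cblinfun_apply diagonal_op (a \<otimes>\<^sub>t b) = a * b"
  unfolding diagonal_op_def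
  by (rule ptensor_lift_tensor, rule bounded_cbilinear_intro[of _ 1])
    (simp_all add: distrib_left distrib_right mult_scaleC_left mult_scaleC_right norm_mult_ineq)

type_synonym 'a dual = "'a \<Rightarrow>\<^sub>C\<^sub>L complex"

lift_definition adjoint ::
    "('a::complex_normed_vector \<Rightarrow>\<^sub>C\<^sub>L 'b::complex_normed_vector) \<Rightarrow> ('b dual \<Rightarrow>\<^sub>C\<^sub>L 'a dual)"
  is "\<lambda>T \<phi>. \<phi> o\<^sub>C T"
proof -
  fix T :: "'a \<Rightarrow>\<^sub>C\<^sub>L 'b"
  have "norm (\<phi> o\<^sub>C T) \<le> norm T * norm \<phi>" for \<phi> :: "'b dual"
  proof (rule norm_cblinfun_bound)
    fix x
    have "norm (\<phi> (T x)) \<le> norm \<phi> * (norm T * norm x)"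
      by (rule order_trans[OF norm_cblinfun mult_left_mono[OF norm_cblinfun]]) simp
    then show "norm ((\<phi> o\<^sub>C T) x) \<le> norm T * norm \<phi> * norm x" by (simp add: mult_ac)
  qed simp
  then show "bounded_clinear (\<lambda>\<phi> :: 'b dual. \<phi> o\<^sub>C T)"
    by (intro bounded_clinear_intro) (auto intro!: cblinfun_eqI simp: cblinfun_simps)
qed

text \<open>
  The dual of a bimodule \<open>X\<close> over \<open>'a\<close> whose actions are \<open>x \<mapsto> L a x\<close> (left) and \<open>x \<mapsto> R a x\<close> (right):
  \<open>\<langle>a \<cdot> \<phi>, x\<rangle> = \<langle>\<phi>, x \<cdot> a\<rangle>\<close> and \<open>\<langle>\<phi> \<cdot> a, x\<rangle> = \<langle>\<phi>, a \<cdot> x\<rangle>\<close>.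
\<close>

definition dual_lact ::
    "('a \<Rightarrow> ('x::complex_normed_vector \<Rightarrow>\<^sub>C\<^sub>L 'x)) \<Rightarrow> 'a \<Rightarrow> 'x dual \<Rightarrow> 'x dual"
  where "dual_lact R a \<phi> = \<phi> o\<^sub>C R a"

definition dual_ract ::
    "('a \<Rightarrow> ('x::complex_normed_vector \<Rightarrow>\<^sub>C\<^sub>L 'x)) \<Rightarrow> 'x dual \<Rightarrow> 'a \<Rightarrow> 'x dual"
  where "dual_ract L \<phi> a = \<phi> o\<^sub>C L a"

definition biflat :: "real \<Rightarrow> ('a::complex_banach_algebra \<Rightarrow>\<^sub>C\<^sub>L 'a) \<Rightarrow> bool"
  where "biflat C \<sigma> \<longleftrightarrow>
    (\<exists>\<rho> :: ('a \<otimes>\<^sub>\<pi> 'a) dual \<Rightarrow>\<^sub>C\<^sub>L 'a dual.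
      (\<forall>a \<phi>. cblinfun_apply \<rho> (dual_lact ptensor_ract (\<sigma> a) \<phi>)
        = dual_lact rmult a (cblinfun_apply \<rho> \<phi>)) \<and>
      (\<forall>a \<phi>. cblinfun_apply \<rho> (dual_ract ptensor_lact \<phi> (\<sigma> a))
        = dual_ract lmult (cblinfun_apply \<rho> \<phi>) a) \<and>
      \<rho> o\<^sub>C adjoint diagonal_op = adjoint \<sigma> \<and>
      norm \<rho> < C)"

end

theory Submission
  imports Defs
begin

text \<open>
  Let \<open>\<rho>\<^sub>A\<close> and \<open>\<rho>\<^sub>B\<close> witness the biflatness of \<open>A\<close> and of \<open>B\<close>. The witness for \<open>A \<otimes> B\<close> is a tensor
  product of \<open>\<rho>\<^sub>A\<close> and \<open>\<rho>\<^sub>B\<close>, formed on the level of dual spaces. Regard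
  \<open>\<Phi> \<in> ((A \<otimes> B) \<otimes> (A \<otimes> B))\<^sup>*\<close> as a bounded bilinear form \<open>\<Phi>(x, y)\<close> with \<open>x \<in> A \<otimes> A\<close> and
  \<open>y \<in> B \<otimes> B\<close>, by exchanging the two middle factors. Applying \<open>\<rho>\<^sub>A\<close> in the variable \<open>x\<close> and then
  \<open>\<rho>\<^sub>B\<close> in the variable \<open>y\<close> gives a bounded bilinear form on \<open>A \<times> B\<close>, that is, an element
  of \<open>(A \<otimes> B)\<^sup>*\<close>; each step costs at most a factor \<open>norm \<rho>\<^sub>A\<close> or \<open>norm \<rho>\<^sub>B\<close>, whence
  \<open>norm \<rho> \<le> norm \<rho>\<^sub>A * norm \<rho>\<^sub>B\<close>.

  This is the case \<open>X = A \<otimes> A\<close>, \<open>Y = B \<otimes> B\<close> of a construction \<open>dual_tensor\<close>, which makes a map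
  \<open>Z\<^sup>* \<rightarrow> (A \<otimes> B)\<^sup>*\<close> from maps \<open>X\<^sup>* \<rightarrow> A\<^sup>*\<close>, \<open>Y\<^sup>* \<rightarrow> B\<^sup>*\<close> and a bounded bilinear map \<open>Y \<times> X \<rightarrow> Z\<close>. It
  is natural in all its arguments (\<open>dual_tensor_natural\<close>), and the conditions on \<open>\<rho>\<close> are three
  instances of this naturality: in the two module identities, where \<open>A \<otimes> B\<close> acts by an elementary
  tensor \<open>a \<otimes> b\<close>, the actions of \<open>a\<close> and \<open>b\<close> are carried along; in
  \<open>\<rho> \<circ> \<pi>\<^sup>* = (\<sigma>\<^sub>A \<otimes> \<sigma>\<^sub>B)\<^sup>*\<close> the diagonal operators are, and the construction is compared with
  the tensor product of two identity maps. Linearity and continuity extend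
  the module identities to all of \<open>A \<otimes> B\<close>.
\<close>

section \<open>Composition and interchange of arguments\<close>

lemma norm_cblinfun_compose: "norm (g o\<^sub>C f) \<le> norm g * norm f"
proof (rule norm_cblinfun_bound)
  show "norm ((g o\<^sub>C f) x) \<le> norm g * norm f * norm x" for x
    using order_trans[OF norm_cblinfun[of g "f x"] mult_left_mono[OF norm_cblinfun[of f x]]]
    by (simp add: mult.assoc)
qed simp

lemma bounded_clinear_compose:
  assumes "bounded_clinear g" "bounded_clinear f"
  shows "bounded_clinear (\<lambda>x. g (f x))"
  using assms by (auto simp: bounded_clinear_def intro: bounded_linear_compose)

text \<open>Composition with a fixed map on the left, as a bounded linear operator.\<close>

lift_definition postcompose ::
    "('b::complex_normed_vector \<Rightarrow>\<^sub>C\<^sub>L 'c::complex_normed_vector) \<Rightarrow>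
      (('a::complex_normed_vector \<Rightarrow>\<^sub>C\<^sub>L 'b) \<Rightarrow>\<^sub>C\<^sub>L ('a \<Rightarrow>\<^sub>C\<^sub>L 'c))"
  is "\<lambda>g f. g o\<^sub>C f"
proof -
  fix g :: "'b \<Rightarrow>\<^sub>C\<^sub>L 'c"
  show "bounded_clinear (\<lambda>f :: 'a \<Rightarrow>\<^sub>C\<^sub>L 'b. g o\<^sub>C f)"
    by (rule bounded_clinear_intro[of _ "norm g"])
      (auto intro!: cblinfun_eqI norm_cblinfun_compose simp: cblinfun_simps)
qed

declare postcompose.rep_eq [simp]

lemma norm_postcompose: "norm (postcompose g) \<le> norm g"
  by (rule norm_cblinfun_bound) (simp_all add: norm_cblinfun_compose)

text \<open>The bounded bilinear map \<open>(y, x) \<mapsto> f x y\<close>.\<close>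

definition cblinfun_flip ::
    "('a::complex_normed_vector \<Rightarrow>\<^sub>C\<^sub>L 'b::complex_normed_vector \<Rightarrow>\<^sub>C\<^sub>L 'c::complex_normed_vector)
      \<Rightarrow> ('b \<Rightarrow>\<^sub>C\<^sub>L 'a \<Rightarrow>\<^sub>C\<^sub>L 'c)"
  where "cblinfun_flip f = cbilinear (\<lambda>y x. f x y)"

lemma cblinfun_flip_apply [simp]: "cblinfun_flip f y x = f x y"
  unfolding cblinfun_flip_def
proof (rule cbilinear_apply, rule bounded_cbilinear_intro)
  show "norm (f x y) \<le> norm f * norm y * norm x" for x y
    using bilinear_form_bound[of f x y] by (simp add: mult_ac)
qed (simp_all add: cblinfun_simps)

lemma norm_cblinfun_flip: "norm (cblinfun_flip f) \<le> norm f"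
proof (rule norm_cblinfun_bound)
  show "norm (cblinfun_flip f y) \<le> norm f * norm y" for y
  proof (rule norm_cblinfun_bound)
    show "norm (cblinfun_flip f y x) \<le> norm f * norm y * norm x" for x
      using bilinear_form_bound[of f x y] by (simp add: mult_ac)
  qed simp
qed simp

lemma bounded_cbilinear_cblinfun: "bounded_cbilinear (\<lambda>x y. cblinfun_apply (cblinfun_apply f x) y)"
proof (rule bounded_cbilinear_intro)
  show "norm (f x y) \<le> norm f * norm x * norm y" for x y
    using bilinear_form_bound[of f x y] by (simp add: mult.assoc)
qed (simp_all add: cblinfun_simps)


section \<open>The tensor product of two operators between dual spaces\<close>

text \<open>
  \<open>dual_form V \<rho>\<^sub>1 \<rho>\<^sub>2 \<Phi>\<close> is the bilinear form on \<open>'a \<times> 'b\<close> obtained from the form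
  \<open>(x, y) \<mapsto> \<Phi> (V y x)\<close> by applying \<open>\<rho>\<^sub>1\<close> in \<open>x\<close> for each \<open>y\<close>, and then \<open>\<rho>\<^sub>2\<close> in \<open>y\<close> for each element
  of \<open>'a\<close>. The bilinear map \<open>V\<close> takes \<open>y\<close> first because \<open>\<rho>\<^sub>1\<close> acts on functions of \<open>x\<close> with \<open>y\<close> fixed.
\<close>

definition dual_form ::
    "('y::complex_normed_vector \<Rightarrow>\<^sub>C\<^sub>L 'x::complex_normed_vector \<Rightarrow>\<^sub>C\<^sub>L 'z::complex_normed_vector) \<Rightarrow>
      ('x dual \<Rightarrow>\<^sub>C\<^sub>L 'a::complex_normed_vector dual) \<Rightarrow>
      ('y dual \<Rightarrow>\<^sub>C\<^sub>L 'b::complex_normed_vector dual) \<Rightarrow>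
      'z dual \<Rightarrow> ('a \<Rightarrow>\<^sub>C\<^sub>L 'b dual)"
  where "dual_form V \<rho>\<^sub>1 \<rho>\<^sub>2 \<Phi> = \<rho>\<^sub>2 o\<^sub>C cblinfun_flip (\<rho>\<^sub>1 o\<^sub>C (postcompose \<Phi> o\<^sub>C V))"

lemma norm_dual_form:
  fixes V :: "'y::complex_normed_vector \<Rightarrow>\<^sub>C\<^sub>L 'x::complex_normed_vector \<Rightarrow>\<^sub>C\<^sub>L 'z::complex_normed_vector"
  shows "norm (dual_form V \<rho>\<^sub>1 \<rho>\<^sub>2 \<Phi>) \<le> norm V * norm \<rho>\<^sub>1 * norm \<rho>\<^sub>2 * norm \<Phi>"
proof -
  have "norm (dual_form V \<rho>\<^sub>1 \<rho>\<^sub>2 \<Phi>) \<le>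
      norm \<rho>\<^sub>2 * norm (cblinfun_flip (\<rho>\<^sub>1 o\<^sub>C (postcompose \<Phi> o\<^sub>C V)))"
    unfolding dual_form_def by (rule norm_cblinfun_compose)
  also have "\<dots> \<le> norm \<rho>\<^sub>2 * norm (\<rho>\<^sub>1 o\<^sub>C (postcompose \<Phi> o\<^sub>C V))"
    by (intro mult_left_mono norm_cblinfun_flip) simp
  also have "\<dots> \<le> norm \<rho>\<^sub>2 * (norm \<rho>\<^sub>1 * norm (postcompose \<Phi> o\<^sub>C V))"
    by (intro mult_left_mono norm_cblinfun_compose) simp
  also have "\<dots> \<le> norm \<rho>\<^sub>2 * (norm \<rho>\<^sub>1 * (norm (postcompose \<Phi> :: ('x \<Rightarrow>\<^sub>C\<^sub>L 'z) \<Rightarrow>\<^sub>C\<^sub>L _) * norm V))"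
    by (intro mult_left_mono norm_cblinfun_compose) simp_all
  also have "\<dots> \<le> norm \<rho>\<^sub>2 * (norm \<rho>\<^sub>1 * (norm \<Phi> * norm V))"
    by (intro mult_left_mono mult_right_mono norm_postcompose) simp_all
  finally show ?thesis by (simp add: mult_ac)
qed

lemma dual_form_add: "dual_form V \<rho>\<^sub>1 \<rho>\<^sub>2 (\<Phi> + \<Psi>) = dual_form V \<rho>\<^sub>1 \<rho>\<^sub>2 \<Phi> + dual_form V \<rho>\<^sub>1 \<rho>\<^sub>2 \<Psi>"
proof -
  have 1: "(\<Phi> + \<Psi>) o\<^sub>C f = (\<Phi> o\<^sub>C f) + (\<Psi> o\<^sub>C f)" for f :: "_ \<Rightarrow>\<^sub>C\<^sub>L _"
    by (rule cblinfun_eqI) (simp add: cblinfun_simps)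
  have "cblinfun_flip (\<rho>\<^sub>1 o\<^sub>C (postcompose (\<Phi> + \<Psi>) o\<^sub>C V)) a =
      cblinfun_flip (\<rho>\<^sub>1 o\<^sub>C (postcompose \<Phi> o\<^sub>C V)) a + cblinfun_flip (\<rho>\<^sub>1 o\<^sub>C (postcompose \<Psi> o\<^sub>C V)) a" for a
    by (rule cblinfun_eqI) (simp add: 1 cblinfun_simps)
  then show ?thesis by (intro cblinfun_eqI) (simp add: dual_form_def cblinfun_simps)
qed

lemma dual_form_scaleC: "dual_form V \<rho>\<^sub>1 \<rho>\<^sub>2 (c *\<^sub>C \<Phi>) = c *\<^sub>C dual_form V \<rho>\<^sub>1 \<rho>\<^sub>2 \<Phi>"
proof -
  have 1: "(c *\<^sub>C \<Phi>) o\<^sub>C f = c *\<^sub>C (\<Phi> o\<^sub>C f)" for f :: "_ \<Rightarrow>\<^sub>C\<^sub>L _"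
    by (rule cblinfun_eqI) (simp add: cblinfun_simps)
  have "cblinfun_flip (\<rho>\<^sub>1 o\<^sub>C (postcompose (c *\<^sub>C \<Phi>) o\<^sub>C V)) a =
      c *\<^sub>C cblinfun_flip (\<rho>\<^sub>1 o\<^sub>C (postcompose \<Phi> o\<^sub>C V)) a" for a
    by (rule cblinfun_eqI) (simp add: 1 cblinfun_simps)
  then show ?thesis by (intro cblinfun_eqI) (simp add: dual_form_def cblinfun_simps)
qed

text \<open>The operator \<open>\<Phi> \<mapsto> dual_form V \<rho>\<^sub>1 \<rho>\<^sub>2 \<Phi>\<close>, with bilinear forms read as functionals on \<open>'a \<otimes> 'b\<close>.\<close>

definition dual_tensor ::
    "('y::complex_normed_vector \<Rightarrow>\<^sub>C\<^sub>L 'x::complex_normed_vector \<Rightarrow>\<^sub>C\<^sub>L 'z::complex_normed_vector) \<Rightarrow>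
      ('x dual \<Rightarrow>\<^sub>C\<^sub>L 'a::complex_normed_vector dual) \<Rightarrow>
      ('y dual \<Rightarrow>\<^sub>C\<^sub>L 'b::complex_normed_vector dual) \<Rightarrow>
      ('z dual \<Rightarrow>\<^sub>C\<^sub>L ('a \<otimes>\<^sub>\<pi> 'b) dual)"
  where "dual_tensor V \<rho>\<^sub>1 \<rho>\<^sub>2 = CBlinfun (\<lambda>\<Phi>. ptensor_lift (\<lambda>a b. dual_form V \<rho>\<^sub>1 \<rho>\<^sub>2 \<Phi> a b))"

lemma
  shows dual_tensor_tensor:
      "cblinfun_apply (cblinfun_apply (dual_tensor V \<rho>\<^sub>1 \<rho>\<^sub>2) \<Phi>) (a \<otimes>\<^sub>t b) = dual_form V \<rho>\<^sub>1 \<rho>\<^sub>2 \<Phi> a b"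
    and norm_dual_tensor: "norm (dual_tensor V \<rho>\<^sub>1 \<rho>\<^sub>2) \<le> norm V * norm \<rho>\<^sub>1 * norm \<rho>\<^sub>2"
proof -
  define L where "L \<Phi> = ptensor_lift (\<lambda>a b. dual_form V \<rho>\<^sub>1 \<rho>\<^sub>2 \<Phi> a b)" for \<Phi>
  have L: "L \<Phi> (a \<otimes>\<^sub>t b) = dual_form V \<rho>\<^sub>1 \<rho>\<^sub>2 \<Phi> a b" for \<Phi> a b
    unfolding L_def by (rule ptensor_lift_tensor[OF bounded_cbilinear_cblinfun])
  have norm: "norm (L \<Phi>) \<le> norm V * norm \<rho>\<^sub>1 * norm \<rho>\<^sub>2 * norm \<Phi>" for \<Phi>
  proof (rule norm_ptensor_bound)
    fix a b
    have "norm (L \<Phi> (a \<otimes>\<^sub>t b)) \<le> norm (dual_form V \<rho>\<^sub>1 \<rho>\<^sub>2 \<Phi>) * (norm a * norm b)"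
      unfolding L by (rule bilinear_form_bound)
    also have "\<dots> \<le> norm V * norm \<rho>\<^sub>1 * norm \<rho>\<^sub>2 * norm \<Phi> * (norm a * norm b)"
      by (intro mult_right_mono norm_dual_form) simp
    finally show "norm (L \<Phi> (a \<otimes>\<^sub>t b)) \<le> norm V * norm \<rho>\<^sub>1 * norm \<rho>\<^sub>2 * norm \<Phi> * norm a * norm b"
      by (simp add: mult.assoc)
  qed simp
  have "bounded_clinear L"
  proof (rule bounded_clinear_intro[OF _ _ norm])
    show "L (\<Phi> + \<Psi>) = L \<Phi> + L \<Psi>" for \<Phi> \<Psi>
      by (rule ptensor_cblinfun_eqI) (simp only: L cblinfun.add_left dual_form_add)
    show "L (c *\<^sub>C \<Phi>) = c *\<^sub>C L \<Phi>" for c \<Phi>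
      by (rule ptensor_cblinfun_eqI) (simp only: L cblinfun_scaleC_left dual_form_scaleC)
  qed
  then have eq: "dual_tensor V \<rho>\<^sub>1 \<rho>\<^sub>2 \<Phi> = L \<Phi>" for \<Phi>
    by (simp add: dual_tensor_def CBlinfun_apply flip: L_def)
  show "dual_tensor V \<rho>\<^sub>1 \<rho>\<^sub>2 \<Phi> (a \<otimes>\<^sub>t b) = dual_form V \<rho>\<^sub>1 \<rho>\<^sub>2 \<Phi> a b"
    unfolding eq by (rule L)
  show "norm (dual_tensor V \<rho>\<^sub>1 \<rho>\<^sub>2) \<le> norm V * norm \<rho>\<^sub>1 * norm \<rho>\<^sub>2"
    by (rule norm_cblinfun_bound) (simp_all add: eq norm)
qed

text \<open>
  The hypotheses say \<open>\<rho>\<^sub>i \<circ> P\<^sub>i\<^sup>* = Q\<^sub>i\<^sup>* \<circ> \<rho>\<^sub>i'\<close> and that \<open>M\<close>, \<open>P\<^sub>1\<close>, \<open>P\<^sub>2\<close> intertwine the bilinear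
  maps \<open>V\<close> and \<open>V'\<close>; the conclusion is the corresponding identity for the tensor products.
\<close>

lemma dual_tensor_natural:
  fixes V :: "'y::complex_normed_vector \<Rightarrow>\<^sub>C\<^sub>L 'x::complex_normed_vector \<Rightarrow>\<^sub>C\<^sub>L 'z::complex_normed_vector"
    and V' :: "'y'::complex_normed_vector \<Rightarrow>\<^sub>C\<^sub>L 'x'::complex_normed_vector \<Rightarrow>\<^sub>C\<^sub>L 'z'::complex_normed_vector"
    and P\<^sub>1 :: "'x \<Rightarrow>\<^sub>C\<^sub>L 'x'" and P\<^sub>2 :: "'y \<Rightarrow>\<^sub>C\<^sub>L 'y'"
  assumes 1: "\<And>\<phi>. cblinfun_apply \<rho>\<^sub>1 (\<phi> o\<^sub>C P\<^sub>1) = cblinfun_apply \<rho>\<^sub>1' \<phi> o\<^sub>C Q\<^sub>1"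
    and 2: "\<And>\<phi>. cblinfun_apply \<rho>\<^sub>2 (\<phi> o\<^sub>C P\<^sub>2) = cblinfun_apply \<rho>\<^sub>2' \<phi> o\<^sub>C Q\<^sub>2"
    and M: "\<And>x y. cblinfun_apply M (V y x) = V' (P\<^sub>2 y) (P\<^sub>1 x)"
  shows "dual_tensor V \<rho>\<^sub>1 \<rho>\<^sub>2 (\<Phi> o\<^sub>C M) = dual_tensor V' \<rho>\<^sub>1' \<rho>\<^sub>2' \<Phi> o\<^sub>C ptensor_map Q\<^sub>1 Q\<^sub>2"
proof (rule ptensor_cblinfun_eqI)
  fix a b
  have "(\<Phi> o\<^sub>C M) o\<^sub>C V y = (\<Phi> o\<^sub>C V' (P\<^sub>2 y)) o\<^sub>C P\<^sub>1" for y
    by (rule cblinfun_eqI) (simp add: M)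
  then have "cblinfun_flip (\<rho>\<^sub>1 o\<^sub>C (postcompose (\<Phi> o\<^sub>C M) o\<^sub>C V)) a =
      cblinfun_flip (\<rho>\<^sub>1' o\<^sub>C (postcompose \<Phi> o\<^sub>C V')) (Q\<^sub>1 a) o\<^sub>C P\<^sub>2"
    by (intro cblinfun_eqI) (simp add: 1)
  then show "dual_tensor V \<rho>\<^sub>1 \<rho>\<^sub>2 (\<Phi> o\<^sub>C M) (a \<otimes>\<^sub>t b) =
      (dual_tensor V' \<rho>\<^sub>1' \<rho>\<^sub>2' \<Phi> o\<^sub>C ptensor_map Q\<^sub>1 Q\<^sub>2) (a \<otimes>\<^sub>t b)"
    by (simp add: dual_tensor_tensor ptensor_map_tensor dual_form_def 2)
qed

lemma dual_tensor_id:
  "dual_tensor (cblinfun_flip (cbilinear tensor)) cblinfun_id cblinfun_id = cblinfun_id"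
  by (rule cblinfun_eqI, rule ptensor_cblinfun_eqI)
    (simp add: dual_tensor_tensor dual_form_def cbilinear_apply bounded_cbilinear_tensor)


section \<open>Exchanging the middle factors of a fourfold tensor product\<close>

text \<open>\<open>tensor_with b\<close> is the map \<open>a \<mapsto> a \<otimes> b\<close>.\<close>

definition tensor_with ::
    "'b::complex_normed_vector \<Rightarrow> ('a::complex_normed_vector \<Rightarrow>\<^sub>C\<^sub>L 'a \<otimes>\<^sub>\<pi> 'b)"
  where "tensor_with b = cblinfun_flip (cbilinear tensor) b"

lemma tensor_with_apply [simp]: "cblinfun_apply (tensor_with b) a = a \<otimes>\<^sub>t b"
  by (simp add: tensor_with_def cbilinear_apply bounded_cbilinear_tensor)

text \<open>The bounded bilinear map with \<open>(b \<otimes> b', a \<otimes> a') \<mapsto> (a \<otimes> b) \<otimes> (a' \<otimes> b')\<close>.\<close>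

definition tensor_interchange ::
    "'b::complex_normed_vector \<otimes>\<^sub>\<pi> 'd::complex_normed_vector \<Rightarrow>\<^sub>C\<^sub>L
      'a::complex_normed_vector \<otimes>\<^sub>\<pi> 'c::complex_normed_vector \<Rightarrow>\<^sub>C\<^sub>L
      ('a \<otimes>\<^sub>\<pi> 'b) \<otimes>\<^sub>\<pi> ('c \<otimes>\<^sub>\<pi> 'd)"
  where "tensor_interchange = ptensor_lift (\<lambda>b b'. ptensor_map (tensor_with b) (tensor_with b'))"

lemma norm_ptensor_map_tensor_with:
  "norm (ptensor_map (tensor_with b) (tensor_with b')) \<le> norm b * norm b'"
  by (rule norm_ptensor_bound) (simp_all add: ptensor_map_tensor norm_tensor mult_ac)

lemma
  shows tensor_interchange_left: "cblinfun_apply tensor_interchange (b \<otimes>\<^sub>t b') =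
      ptensor_map (tensor_with b) (tensor_with b')"
    and norm_tensor_interchange: "norm tensor_interchange \<le> 1"
proof -
  have "bounded_cbilinear (\<lambda>b b'. ptensor_map (tensor_with b) (tensor_with b'))"
  proof (rule bounded_cbilinear_intro[of _ 1])
    show "norm (ptensor_map (tensor_with b) (tensor_with b')) \<le> 1 * norm b * norm b'" for b b'
      using norm_ptensor_map_tensor_with[of b b'] by simp
  qed (rule ptensor_cblinfun_eqI; simp add: ptensor_map_tensor cblinfun_simps
      tensor_add_left tensor_add_right tensor_scaleC_left tensor_scaleC_right)+
  then show eq: "tensor_interchange (b \<otimes>\<^sub>t b') = ptensor_map (tensor_with b) (tensor_with b')" for b b'
    unfolding tensor_interchange_def by (rule ptensor_lift_tensor)
  show "norm tensor_interchange \<le> 1"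
    by (rule norm_ptensor_bound) (simp_all add: eq norm_ptensor_map_tensor_with)
qed

lemma tensor_interchange_tensor:
  "cblinfun_apply (cblinfun_apply tensor_interchange (b \<otimes>\<^sub>t b')) (a \<otimes>\<^sub>t a') =
    (a \<otimes>\<^sub>t b) \<otimes>\<^sub>t (a' \<otimes>\<^sub>t b')"
  by (simp add: tensor_interchange_left ptensor_map_tensor)

text \<open>
  For \<open>V = tensor_interchange\<close>, the third hypothesis of \<open>dual_tensor_natural\<close> need only be checked on
  elementary tensors.
\<close>

lemma tensor_interchange_ext:
  fixes P\<^sub>1 :: "'a::complex_normed_vector \<otimes>\<^sub>\<pi> 'c::complex_normed_vector \<Rightarrow>\<^sub>C\<^sub>L 'x::complex_normed_vector"
    and P\<^sub>2 :: "'b::complex_normed_vector \<otimes>\<^sub>\<pi> 'd::complex_normed_vector \<Rightarrow>\<^sub>C\<^sub>L 'y::complex_normed_vector"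
    and V' :: "'y \<Rightarrow>\<^sub>C\<^sub>L 'x \<Rightarrow>\<^sub>C\<^sub>L 'z::complex_normed_vector"
  assumes "\<And>a a' b b'. cblinfun_apply M ((a \<otimes>\<^sub>t b) \<otimes>\<^sub>t (a' \<otimes>\<^sub>t b')) =
    cblinfun_apply (cblinfun_apply V' (P\<^sub>2 (b \<otimes>\<^sub>t b'))) (P\<^sub>1 (a \<otimes>\<^sub>t a'))"
  shows "cblinfun_apply M (tensor_interchange y x) = V' (P\<^sub>2 y) (P\<^sub>1 x)"
proof -
  have "M o\<^sub>C cblinfun_flip tensor_interchange (a \<otimes>\<^sub>t a') = cblinfun_flip V' (P\<^sub>1 (a \<otimes>\<^sub>t a')) o\<^sub>C P\<^sub>2" for a a'
    by (rule ptensor_cblinfun_eqI) (simp add: tensor_interchange_tensor assms)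
  from arg_cong[OF this, of "\<lambda>T. cblinfun_apply T y"]
  have "M (tensor_interchange y (a \<otimes>\<^sub>t a')) = V' (P\<^sub>2 y) (P\<^sub>1 (a \<otimes>\<^sub>t a'))" for a a'
    by simp
  then have "M o\<^sub>C tensor_interchange y = V' (P\<^sub>2 y) o\<^sub>C P\<^sub>1"
    by (intro ptensor_cblinfun_eqI) simp
  from arg_cong[OF this, of "\<lambda>T. cblinfun_apply T x"] show ?thesis by simp
qed


section \<open>Continuity of the module actions\<close>

lemma bounded_clinear_lmult: "bounded_clinear lmult"
  by (rule bounded_clinear_intro[of _ 1])
    (auto intro!: cblinfun_eqI simp: norm_lmult cblinfun_simps distrib_right mult_scaleC_left)

lemma norm_rmult: "norm (rmult a) \<le> norm a"
  by (rule norm_cblinfun_bound) (simp_all add: norm_mult_ineq mult.commute[of "norm a"])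

lemma bounded_clinear_rmult: "bounded_clinear rmult"
  by (rule bounded_clinear_intro[of _ 1])
    (auto intro!: cblinfun_eqI simp: norm_rmult cblinfun_simps distrib_left mult_scaleC_right)

lemma bounded_clinear_ptensor_lact: "bounded_clinear ptensor_lact"
proof (rule bounded_clinear_intro[of _ 1])
  show "norm (ptensor_lact a) \<le> 1 * norm a" for a :: 'a
    by (rule norm_ptensor_bound)
      (simp_all add: ptensor_lact_tensor norm_tensor mult_right_mono norm_mult_ineq)
qed (rule ptensor_cblinfun_eqI; simp add: ptensor_lact_tensor cblinfun_simps distrib_right
    mult_scaleC_left tensor_add_left tensor_scaleC_left)+

lemma bounded_clinear_ptensor_ract: "bounded_clinear ptensor_ract"
proof (rule bounded_clinear_intro[of _ 1])
  show "norm (ptensor_ract a) \<le> 1 * norm a" for a :: 'a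
  proof (rule norm_ptensor_bound)
    fix b c :: 'a
    have "norm b * norm (c * a) \<le> norm b * (norm c * norm a)"
      by (intro mult_left_mono norm_mult_ineq) simp
    then show "norm (ptensor_ract a (b \<otimes>\<^sub>t c)) \<le> 1 * norm a * norm b * norm c"
      by (simp add: ptensor_ract_tensor norm_tensor mult_ac)
  qed simp
qed (rule ptensor_cblinfun_eqI; simp add: ptensor_ract_tensor cblinfun_simps distrib_left
    mult_scaleC_right tensor_add_right tensor_scaleC_right)+

lemma lmult_tensor: "lmult (a \<otimes>\<^sub>t b) = ptensor_map (lmult a) (lmult b)"
  by (rule ptensor_cblinfun_eqI) (simp add: tensor_mult ptensor_map_tensor)

lemma rmult_tensor: "rmult (a \<otimes>\<^sub>t b) = ptensor_map (rmult a) (rmult b)"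
  by (rule ptensor_cblinfun_eqI) (simp add: tensor_mult ptensor_map_tensor)

text \<open>
  A module identity \<open>\<rho> (\<Phi> \<circ> act (\<sigma> u)) = \<rho> \<Phi> \<circ> act' u\<close> for all \<open>u \<in> 'a \<otimes> 'b\<close> need only be checked on
  elementary tensors \<open>u\<close>.
\<close>

lemma intertwining_ext:
  fixes \<sigma> :: "'a::complex_normed_vector \<otimes>\<^sub>\<pi> 'b::complex_normed_vector \<Rightarrow>\<^sub>C\<^sub>L 'c::complex_normed_vector"
  assumes act: "bounded_clinear act" "bounded_clinear act'"
    and eq: "\<And>a b. cblinfun_apply \<rho> (\<Phi> o\<^sub>C act (\<sigma> (a \<otimes>\<^sub>t b))) = cblinfun_apply \<rho> \<Phi> o\<^sub>C act' (a \<otimes>\<^sub>t b)"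
  shows "cblinfun_apply \<rho> (\<Phi> o\<^sub>C act (cblinfun_apply \<sigma> u)) = cblinfun_apply \<rho> \<Phi> o\<^sub>C act' u"
proof -
  have "bounded_clinear (\<lambda>u. (\<rho> o\<^sub>C postcompose \<Phi>) (act (\<sigma> u)))"
    by (intro bounded_clinear_compose[OF bounded_clinear_apply]
        bounded_clinear_compose[OF act(1) bounded_clinear_apply])
  moreover have "bounded_clinear (\<lambda>u. postcompose (\<rho> \<Phi>) (act' u))"
    by (rule bounded_clinear_compose[OF bounded_clinear_apply act(2)])
  ultimately have "(\<rho> o\<^sub>C postcompose \<Phi>) (act (\<sigma> u)) = postcompose (\<rho> \<Phi>) (act' u)"
    by (rule ptensor_ext) (simp add: eq)
  then show ?thesis by simp
qed


section \<open>Biflatness of the tensor product\<close>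

theorem theorem5p1:
  fixes C\<^sub>1 C\<^sub>2 :: real
    and \<sigma>\<^sub>A :: "'a::complex_banach_algebra \<Rightarrow>\<^sub>C\<^sub>L 'a"
    and \<sigma>\<^sub>B :: "'b::complex_banach_algebra \<Rightarrow>\<^sub>C\<^sub>L 'b"
  assumes "C\<^sub>1 > 0" and "C\<^sub>2 > 0"
    and "\<sigma>\<^sub>A \<in> Hom" and "\<sigma>\<^sub>B \<in> Hom"
    and "biflat C\<^sub>1 \<sigma>\<^sub>A" and "biflat C\<^sub>2 \<sigma>\<^sub>B"
    and "\<sigma>\<^sub>A o\<^sub>C \<sigma>\<^sub>A = \<sigma>\<^sub>A" and "\<sigma>\<^sub>B o\<^sub>C \<sigma>\<^sub>B = \<sigma>\<^sub>B"
  shows "biflat (C\<^sub>1 * C\<^sub>2) (ptensor_map \<sigma>\<^sub>A \<sigma>\<^sub>B)"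
proof -
  obtain \<rho>\<^sub>A :: "('a \<otimes>\<^sub>\<pi> 'a) dual \<Rightarrow>\<^sub>C\<^sub>L 'a dual"
    where A: "\<And>a \<phi>. \<rho>\<^sub>A (\<phi> o\<^sub>C ptensor_ract (\<sigma>\<^sub>A a)) = \<rho>\<^sub>A \<phi> o\<^sub>C rmult a"
      "\<And>a \<phi>. \<rho>\<^sub>A (\<phi> o\<^sub>C ptensor_lact (\<sigma>\<^sub>A a)) = \<rho>\<^sub>A \<phi> o\<^sub>C lmult a"
      "\<rho>\<^sub>A o\<^sub>C adjoint diagonal_op = adjoint \<sigma>\<^sub>A" "norm \<rho>\<^sub>A < C\<^sub>1"
    using \<open>biflat C\<^sub>1 \<sigma>\<^sub>A\<close> unfolding biflat_def dual_lact_def dual_ract_def by blast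
  obtain \<rho>\<^sub>B :: "('b \<otimes>\<^sub>\<pi> 'b) dual \<Rightarrow>\<^sub>C\<^sub>L 'b dual"
    where B: "\<And>b \<phi>. \<rho>\<^sub>B (\<phi> o\<^sub>C ptensor_ract (\<sigma>\<^sub>B b)) = \<rho>\<^sub>B \<phi> o\<^sub>C rmult b"
      "\<And>b \<phi>. \<rho>\<^sub>B (\<phi> o\<^sub>C ptensor_lact (\<sigma>\<^sub>B b)) = \<rho>\<^sub>B \<phi> o\<^sub>C lmult b"
      "\<rho>\<^sub>B o\<^sub>C adjoint diagonal_op = adjoint \<sigma>\<^sub>B" "norm \<rho>\<^sub>B < C\<^sub>2"
    using \<open>biflat C\<^sub>2 \<sigma>\<^sub>B\<close> unfolding biflat_def dual_lact_def dual_ract_def by blast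
  have A3: "\<rho>\<^sub>A (\<phi> o\<^sub>C diagonal_op) = cblinfun_id \<phi> o\<^sub>C \<sigma>\<^sub>A" for \<phi>
    using arg_cong[OF A(3), of "\<lambda>T. cblinfun_apply T \<phi>"] by (simp add: adjoint.rep_eq)
  have B3: "\<rho>\<^sub>B (\<phi> o\<^sub>C diagonal_op) = cblinfun_id \<phi> o\<^sub>C \<sigma>\<^sub>B" for \<phi>
    using arg_cong[OF B(3), of "\<lambda>T. cblinfun_apply T \<phi>"] by (simp add: adjoint.rep_eq)
  define \<rho> where "\<rho> = dual_tensor tensor_interchange \<rho>\<^sub>A \<rho>\<^sub>B"
  let ?\<sigma> = "ptensor_map \<sigma>\<^sub>A \<sigma>\<^sub>B"
  have right: "\<rho> (\<Phi> o\<^sub>C ptensor_ract (?\<sigma> u)) = \<rho> \<Phi> o\<^sub>C rmult u" for u \<Phi>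
  proof (rule intertwining_ext[OF bounded_clinear_ptensor_ract bounded_clinear_rmult])
    show "\<rho> (\<Phi> o\<^sub>C ptensor_ract (?\<sigma> (a \<otimes>\<^sub>t b))) = \<rho> \<Phi> o\<^sub>C rmult (a \<otimes>\<^sub>t b)" for a b
      unfolding \<rho>_def rmult_tensor
      by (rule dual_tensor_natural[OF A(1) B(1)], rule tensor_interchange_ext)
        (simp add: ptensor_ract_tensor ptensor_map_tensor tensor_mult tensor_interchange_tensor)
  qed
  have left: "\<rho> (\<Phi> o\<^sub>C ptensor_lact (?\<sigma> u)) = \<rho> \<Phi> o\<^sub>C lmult u" for u \<Phi>
  proof (rule intertwining_ext[OF bounded_clinear_ptensor_lact bounded_clinear_lmult])
    show "\<rho> (\<Phi> o\<^sub>C ptensor_lact (?\<sigma> (a \<otimes>\<^sub>t b))) = \<rho> \<Phi> o\<^sub>C lmult (a \<otimes>\<^sub>t b)" for a b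
      unfolding \<rho>_def lmult_tensor
      by (rule dual_tensor_natural[OF A(2) B(2)], rule tensor_interchange_ext)
        (simp add: ptensor_lact_tensor ptensor_map_tensor tensor_mult tensor_interchange_tensor)
  qed
  have diagonal: "\<rho> o\<^sub>C adjoint diagonal_op = adjoint ?\<sigma>"
  proof (rule cblinfun_eqI)
    fix \<Phi> :: "('a \<otimes>\<^sub>\<pi> 'b) dual"
    have "\<rho> (\<Phi> o\<^sub>C diagonal_op) =
        dual_tensor (cblinfun_flip (cbilinear tensor)) cblinfun_id cblinfun_id \<Phi> o\<^sub>C ?\<sigma>"
      unfolding \<rho>_def
      by (rule dual_tensor_natural[OF A3 B3], rule tensor_interchange_ext)
        (simp add: diagonal_op_tensor tensor_mult cbilinear_apply bounded_cbilinear_tensor)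
    then show "(\<rho> o\<^sub>C adjoint diagonal_op) \<Phi> = adjoint ?\<sigma> \<Phi>"
      by (simp add: adjoint.rep_eq dual_tensor_id)
  qed
  have "norm \<rho> \<le> norm (tensor_interchange :: 'b \<otimes>\<^sub>\<pi> 'b \<Rightarrow>\<^sub>C\<^sub>L 'a \<otimes>\<^sub>\<pi> 'a \<Rightarrow>\<^sub>C\<^sub>L _) * (norm \<rho>\<^sub>A * norm \<rho>\<^sub>B)"
    unfolding \<rho>_def using norm_dual_tensor by (simp only: mult.assoc)
  also have "\<dots> \<le> 1 * (norm \<rho>\<^sub>A * norm \<rho>\<^sub>B)"
    by (intro mult_right_mono norm_tensor_interchange) simp
  also have "\<dots> < C\<^sub>1 * C\<^sub>2"
    using mult_strict_mono'[OF A(4) B(4)] by simp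
  finally have "norm \<rho> < C\<^sub>1 * C\<^sub>2" .
  then show ?thesis
    unfolding biflat_def dual_lact_def dual_ract_def using right left diagonal by blast
qed

end
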